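(* Let $(A,\alpha)$ be a unital separable C$^*$-dynamical system which is asymptotically abelian with locality. If there is a unique $\alpha$-invariant state $\tau$ on $A$, then $\tau$ is a trace, and $\pi_\tau(A)$ is an abelian algebra.
   Context: $A$ is a unital C$^*$-algebra and $\alpha$ is a $*$-automorphism of $A$. $\pi_\tau$ denotes the GNS-representation of $\tau$. Asymptotically abelian with locality: there is a dense $\alpha$-invariant $*$-subalgebra $\mathcal A$ of $A$ such that for each pair $a,b\in\mathcal A$ the C$^*$-algebra generated by $a$ and $b$ is finite dimensional, and for some $p=p(a,b)\in\mathbb N$ we have $[\alpha^j(a),b]=0$ whenever $|j|\ge p$. *)

theory Defs
  imports "HOL-Analysis.Analysis"
begin

text \<open>
  Unital C*-algebras. The base classes supply the real Banach algebra structure with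
  \<open>norm 1 = 1\<close> (so that the zero algebra, which has no states, is excluded).
\<close>

class cstar_algebra_1 = real_normed_algebra_1 + banach +
  fixes scaleC :: "complex \<Rightarrow> 'a \<Rightarrow> 'a"  (infixr "*\<^sub>C" 75)
    and star :: "'a \<Rightarrow> 'a"
  assumes scaleC_add_right: "c *\<^sub>C (x + y) = c *\<^sub>C x + c *\<^sub>C y"
    and scaleC_add_left: "(c + d) *\<^sub>C x = c *\<^sub>C x + d *\<^sub>C x"
    and scaleC_scaleC: "c *\<^sub>C d *\<^sub>C x = (c * d) *\<^sub>C x"
    and scaleC_of_real: "complex_of_real r *\<^sub>C x = r *\<^sub>R x"
    and mult_scaleC_left: "(c *\<^sub>C x) * y = c *\<^sub>C (x * y)"
    and mult_scaleC_right: "x * (c *\<^sub>C y) = c *\<^sub>C (x * y)"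
    and norm_scaleC: "norm (c *\<^sub>C x) = cmod c * norm x"
    and star_add: "star (x + y) = star x + star y"
    and star_mult: "star (x * y) = star y * star x"
    and star_scaleC: "star (c *\<^sub>C x) = cnj c *\<^sub>C star x"
    and star_star [simp]: "star (star x) = x"
    and cstar_identity: "norm (star x * x) = (norm x)\<^sup>2"

global_interpretation cvec: vector_space "scaleC :: complex \<Rightarrow> 'a \<Rightarrow> 'a::cstar_algebra_1"
proof
  show "1 *\<^sub>C x = x" for x :: 'a
    using scaleC_of_real[of 1 x] by simp
qed (rule scaleC_add_right scaleC_add_left scaleC_scaleC)+

definition star_subalgebra :: "'a::cstar_algebra_1 set \<Rightarrow> bool" where
  "star_subalgebra B \<longleftrightarrow>
     cvec.subspace B \<and> (\<forall>x\<in>B. \<forall>y\<in>B. x * y \<in> B) \<and> (\<forall>x\<in>B. star x \<in> B)"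

definition cstar_subalgebra :: "'a::cstar_algebra_1 set \<Rightarrow> bool" where
  "cstar_subalgebra B \<longleftrightarrow> star_subalgebra B \<and> closed B"

definition cstar_generated :: "'a::cstar_algebra_1 set \<Rightarrow> 'a set" where
  "cstar_generated S = cstar_subalgebra hull S"

definition finite_dim :: "'a::cstar_algebra_1 set \<Rightarrow> bool" where
  "finite_dim V \<longleftrightarrow> (\<exists>B. finite B \<and> V \<subseteq> cvec.span B)"

definition star_automorphism :: "('a::cstar_algebra_1 \<Rightarrow> 'a) \<Rightarrow> bool" where
  "star_automorphism \<alpha> \<longleftrightarrow>
     bij \<alpha> \<and> Vector_Spaces.linear scaleC scaleC \<alpha> \<and>
     (\<forall>x y. \<alpha> (x * y) = \<alpha> x * \<alpha> y) \<and> (\<forall>x. \<alpha> (star x) = star (\<alpha> x))"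

definition int_iterate :: "('a \<Rightarrow> 'a) \<Rightarrow> int \<Rightarrow> 'a \<Rightarrow> 'a" where
  "int_iterate \<alpha> j = (if 0 \<le> j then \<alpha> ^^ nat j else inv \<alpha> ^^ nat (- j))"

definition asymp_abelian_with_locality :: "('a::cstar_algebra_1 \<Rightarrow> 'a) \<Rightarrow> bool" where
  "asymp_abelian_with_locality \<alpha> \<longleftrightarrow>
     (\<exists>B. star_subalgebra B \<and> closure B = UNIV \<and> \<alpha> ` B \<subseteq> B \<and>
       (\<forall>a\<in>B. \<forall>b\<in>B. finite_dim (cstar_generated {a, b}) \<and>
          (\<exists>p::nat. \<forall>j::int. \<bar>j\<bar> \<ge> int p \<longrightarrow>
             int_iterate \<alpha> j a * b = b * int_iterate \<alpha> j a)))"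

definition is_state :: "('a::cstar_algebra_1 \<Rightarrow> complex) \<Rightarrow> bool" where
  "is_state \<tau> \<longleftrightarrow>
     Vector_Spaces.linear scaleC (*) \<tau> \<and> (\<forall>a. \<tau> (star a * a) \<in> \<real>\<^sub>\<ge>\<^sub>0) \<and> \<tau> 1 = 1"

definition invariant_state :: "('a::cstar_algebra_1 \<Rightarrow> 'a) \<Rightarrow> ('a \<Rightarrow> complex) \<Rightarrow> bool" where
  "invariant_state \<alpha> \<tau> \<longleftrightarrow> is_state \<tau> \<and> (\<forall>a. \<tau> (\<alpha> a) = \<tau> a)"

definition tracial :: "('a::cstar_algebra_1 \<Rightarrow> complex) \<Rightarrow> bool" where
  "tracial \<tau> \<longleftrightarrow> (\<forall>a b. \<tau> (a * b) = \<tau> (b * a))"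

text \<open>
  The GNS representation. The GNS space is the completion of the quotient of the algebra by
  \<open>{a. \<tau> (star a * a) = 0}\<close> for the norm \<open>gns_norm \<tau>\<close>. Quotient and completion are taken in
  one step: a vector is a class of sequences in the algebra that are Cauchy for the seminorm, two
  sequences being identified if their difference tends to zero in the seminorm. The operator
  \<open>gns_rep \<tau> a\<close> is the continuous extension of left multiplication by \<open>a\<close>, i.e. it sends the
  class of \<open>x\<close> to the class of \<open>\<lambda>n. a * x n\<close>; see \<open>gns_rep_class\<close> below. As usual for
  functions on a carrier set, it is \<open>undefined\<close> outside the GNS space.
\<close>

definition gns_norm :: "('a::cstar_algebra_1 \<Rightarrow> complex) \<Rightarrow> 'a \<Rightarrow> real" where
  "gns_norm \<tau> a = sqrt (Re (\<tau> (star a * a)))"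

definition gns_cauchy :: "('a::cstar_algebra_1 \<Rightarrow> complex) \<Rightarrow> (nat \<Rightarrow> 'a) set" where
  "gns_cauchy \<tau> = {x. \<forall>e>0. \<exists>N. \<forall>m\<ge>N. \<forall>n\<ge>N. gns_norm \<tau> (x m - x n) < e}"

definition gns_rel :: "('a::cstar_algebra_1 \<Rightarrow> complex) \<Rightarrow> ((nat \<Rightarrow> 'a) \<times> (nat \<Rightarrow> 'a)) set" where
  "gns_rel \<tau> = {(x, y). x \<in> gns_cauchy \<tau> \<and> y \<in> gns_cauchy \<tau> \<and>
                         (\<lambda>n. gns_norm \<tau> (x n - y n)) \<longlonglongrightarrow> 0}"

definition gns_space :: "('a::cstar_algebra_1 \<Rightarrow> complex) \<Rightarrow> (nat \<Rightarrow> 'a) set set" where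
  "gns_space \<tau> = gns_cauchy \<tau> // gns_rel \<tau>"

definition gns_rep ::
  "('a::cstar_algebra_1 \<Rightarrow> complex) \<Rightarrow> 'a \<Rightarrow> (nat \<Rightarrow> 'a) set \<Rightarrow> (nat \<Rightarrow> 'a) set" where
  "gns_rep \<tau> a = (\<lambda>X\<in>gns_space \<tau>. \<Union>x\<in>X. gns_rel \<tau> `` {\<lambda>n. a * x n})"

definition abelian_operators :: "'v set \<Rightarrow> ('v \<Rightarrow> 'v) set \<Rightarrow> bool" where
  "abelian_operators H M \<longleftrightarrow> (\<forall>S\<in>M. \<forall>T\<in>M. compose H S T = compose H T S)"


subsection \<open>Well-definedness of the GNS representation\<close>

lemma scaleC_minus1: "(- 1) *\<^sub>C x = - (x::'a::cstar_algebra_1)"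
  using cvec.scale_minus_left[of 1 x] by simp

lemma star_zero [simp]: "star (0::'a::cstar_algebra_1) = 0"
  using star_add[of 0 "0::'a"] by simp

lemma star_minus: "star (- x) = - star (x::'a::cstar_algebra_1)"
  using star_add[of x "- x"] by (simp add: eq_neg_iff_add_eq_0 add.commute)

lemma star_diff: "star (x - y) = star x - star (y::'a::cstar_algebra_1)"
  using star_add[of x "- y"] by (simp add: star_minus)

lemma star_one [simp]: "star (1::'a::cstar_algebra_1) = 1"
proof -
  have "star (1::'a) = star 1 * star (star 1)"
    by simp
  also have "\<dots> = star (star 1 * 1)"
    by (simp only: star_mult)
  finally show ?thesis
    by simp
qed

lemma star_scaleR: "star (r *\<^sub>R x) = r *\<^sub>R star (x::'a::cstar_algebra_1)"
  using star_scaleC[of "complex_of_real r" x] by (simp add: scaleC_of_real)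

lemma norm_star [simp]: "norm (star x) = norm (x::'a::cstar_algebra_1)"
proof -
  have le: "norm y \<le> norm (star y)" for y :: 'a
  proof (cases "y = 0")
    case False
    have "(norm y)\<^sup>2 \<le> norm (star y) * norm y"
      using norm_mult_ineq[of "star y" y] by (simp add: cstar_identity)
    then show ?thesis
      using False by (simp add: power2_eq_square)
  qed simp
  show ?thesis
    using le[of x] le[of "star x"] by simp
qed

lemma bounded_linear_star: "bounded_linear (star :: 'a::cstar_algebra_1 \<Rightarrow> 'a)"
  by (rule bounded_linear_intro[where K = 1]) (auto simp: star_add star_scaleR)

lemma gbinomial_half_convolution:
  "(\<Sum>i\<le>n. ((1/2::real) gchoose i) * ((1/2) gchoose (n - i))) = (1 gchoose n)"
  using gbinomial_Vandermonde[of "1/2::real" "1/2" n] by (simp add: atLeast0AtMost)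

lemma cstar_sqrt:
  fixes h :: "'a::cstar_algebra_1"
  assumes sa: "star h = h" and lt: "norm h < 1"
  obtains b where "star b = b" "b * b = 1 + h"
proof -
  define f where "f n = ((1/2::real) gchoose n) *\<^sub>R h ^ n" for n
  have "summable (\<lambda>n. norm (((1/2::real) gchoose n) * norm h ^ n))"
    using lt conv_radius_gchoose[of "1/2::real"]
    by (intro abs_summable_in_conv_radius) (auto split: if_splits)
  then have sm: "summable (\<lambda>n. norm (f n))"
    by (rule summable_comparison_test_ev[rotated])
       (auto simp: f_def abs_mult power_abs intro!: always_eventually mult_left_mono norm_power_ineq)
  have star_pow: "star (h ^ n) = h ^ n" for n
    by (induction n) (simp_all add: star_mult sa power_commutes)
  have "star (\<Sum>n. f n) = (\<Sum>n. star (f n))"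
    using bounded_linear.suminf[OF bounded_linear_star summable_norm_cancel[OF sm]] by simp
  also have "(\<lambda>n. star (f n)) = f"
    by (simp add: f_def star_scaleR star_pow fun_eq_iff)
  finally have 1: "star (\<Sum>n. f n) = (\<Sum>n. f n)" .
  have conv: "(\<Sum>i\<le>n. f i * f (n - i)) = ((1::real) gchoose n) *\<^sub>R h ^ n" for n
  proof -
    have "(\<Sum>i\<le>n. f i * f (n - i)) =
            (\<Sum>i\<le>n. (((1/2::real) gchoose i) * ((1/2) gchoose (n - i))) *\<^sub>R h ^ n)"
      by (intro sum.cong) (auto simp: f_def power_add[symmetric])
    also have "\<dots> = ((1::real) gchoose n) *\<^sub>R h ^ n"
      by (simp only: scaleR_sum_left[symmetric] gbinomial_half_convolution)
    finally show ?thesis .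
  qed
  have "(\<lambda>n. ((1::real) gchoose n) *\<^sub>R h ^ n) sums ((\<Sum>n. f n) * (\<Sum>n. f n))"
    using Cauchy_product_sums[OF sm sm] by (simp only: conv)
  moreover have "(\<lambda>n. ((1::real) gchoose n) *\<^sub>R h ^ n) sums
                   (\<Sum>n\<in>{0, 1}. ((1::real) gchoose n) *\<^sub>R h ^ n)"
  proof (rule sums_finite)
    show "((1::real) gchoose n) *\<^sub>R h ^ n = 0" if "n \<notin> {0, 1}" for n
    proof -
      have "(1::real) gchoose n = of_nat (1 choose n)"
        by (metis binomial_gbinomial of_nat_1)
      moreover have "(1::nat) choose n = 0"
        using that by (intro binomial_eq_0) auto
      ultimately show ?thesis
        by simp
    qed
  qed simp
  ultimately have "(\<Sum>n. f n) * (\<Sum>n. f n) = 1 + h"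
    by (simp add: sums_unique2)
  with 1 show thesis
    by (rule that)
qed

context
  fixes \<tau> :: "'a::cstar_algebra_1 \<Rightarrow> complex"
  assumes state: "is_state \<tau>"
begin

lemma state_add: "\<tau> (x + y) = \<tau> x + \<tau> y"
  and state_scaleC: "\<tau> (c *\<^sub>C x) = c * \<tau> x"
  using state by (auto simp: is_state_def Vector_Spaces.linear_iff)

lemma state_minus: "\<tau> (- x) = - \<tau> x"
  using state_scaleC[of "- 1" x] by (simp add: scaleC_minus1)

lemma state_diff: "\<tau> (x - y) = \<tau> x - \<tau> y"
  using state_add[of x "- y"] by (simp add: state_minus)

lemma state_scaleR: "\<tau> (r *\<^sub>R x) = of_real r * \<tau> x"
  using state_scaleC[of "of_real r" x] by (simp add: scaleC_of_real)

lemma state_pos: "Re (\<tau> (star x * x)) \<ge> 0" "Im (\<tau> (star x * x)) = 0"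
  using state by (auto simp: is_state_def complex_nonneg_Reals_iff)

lemma gns_norm_nonneg: "gns_norm \<tau> x \<ge> 0"
  by (simp add: gns_norm_def state_pos)

lemma gns_norm_power2: "(gns_norm \<tau> x)\<^sup>2 = Re (\<tau> (star x * x))"
  by (simp add: gns_norm_def state_pos)

lemma state_Re_sym: "Re (\<tau> (star y * x)) = Re (\<tau> (star x * y))"
proof -
  have "Im (\<tau> (star (x + \<i> *\<^sub>C y) * (x + \<i> *\<^sub>C y))) = 0"
    by (rule state_pos)
  then show ?thesis
    by (simp add: star_add star_scaleC distrib_left distrib_right mult_scaleC_left
        mult_scaleC_right scaleC_scaleC left_diff_distrib scaleC_minus1 state_diff state_minus state_add state_scaleC state_pos)
qed

lemma gns_norm_expand:
  "(gns_norm \<tau> (x + r *\<^sub>R y))\<^sup>2 =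
     (gns_norm \<tau> x)\<^sup>2 + 2 * r * Re (\<tau> (star x * y)) + r\<^sup>2 * (gns_norm \<tau> y)\<^sup>2"
  unfolding gns_norm_power2
  by (simp add: star_add star_scaleR distrib_left distrib_right state_add state_scaleR
      state_Re_sym[of y x] power2_eq_square algebra_simps)

lemma gns_cauchy_schwarz: "\<bar>Re (\<tau> (star x * y))\<bar> \<le> gns_norm \<tau> x * gns_norm \<tau> y"
proof -
  let ?b = "Re (\<tau> (star x * y))" and ?X = "gns_norm \<tau> x" and ?Y = "gns_norm \<tau> y"
  have q: "0 \<le> ?X\<^sup>2 + 2 * r * ?b + r\<^sup>2 * ?Y\<^sup>2" for r
    unfolding gns_norm_expand[symmetric] by simp
  have "?b\<^sup>2 \<le> (?X * ?Y)\<^sup>2"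
  proof (cases "?Y = 0")
    case True
    have "?b = 0"
    proof (rule ccontr)
      assume "?b \<noteq> 0"
      then show False
        using q[of "- (?X\<^sup>2 + 1) / (2 * ?b)"] True by (simp add: field_simps)
    qed
    then show ?thesis
      by simp
  next
    case False
    moreover from this have "?Y * ?Y > 0"
      using zero_less_power2[of ?Y] by (simp add: power2_eq_square)
    ultimately show ?thesis
      using q[of "- ?b / ?Y\<^sup>2"]
      by (simp add: field_simps power2_eq_square zero_le_divide_iff)
  qed
  then show ?thesis
    using power2_le_iff_abs_le[of "?X * ?Y" ?b] by (simp add: gns_norm_nonneg)
qed

lemma gns_norm_triangle: "gns_norm \<tau> (x + y) \<le> gns_norm \<tau> x + gns_norm \<tau> y"
proof (rule power2_le_imp_le)
  show "(gns_norm \<tau> (x + y))\<^sup>2 \<le> (gns_norm \<tau> x + gns_norm \<tau> y)\<^sup>2"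
    using gns_norm_expand[of x 1 y] gns_cauchy_schwarz[of x y] by (simp add: power2_sum)
qed (simp add: gns_norm_nonneg)

lemma gns_norm_minus: "gns_norm \<tau> (- x) = gns_norm \<tau> x"
  by (simp add: gns_norm_def star_minus)

lemma gns_norm_zero: "gns_norm \<tau> 0 = 0"
  using state_scaleC[of 0 0] by (simp add: gns_norm_def)

lemma gns_norm_diff_commute: "gns_norm \<tau> (x - y) = gns_norm \<tau> (y - x)"
  using gns_norm_minus[of "x - y"] by simp

text \<open>
  Left multiplication is bounded: with \<open>k > (norm a)\<^sup>2\<close>, the element \<open>k - star a * a\<close> is
  \<open>k\<close> times the square of a self-adjoint element.
\<close>

lemma gns_norm_mult: "gns_norm \<tau> (a * x) \<le> (norm a + 1) * gns_norm \<tau> x"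
proof (rule power2_le_imp_le)
  define k where "k = (norm a + 1)\<^sup>2"
  have k: "k > 0" "(norm a)\<^sup>2 < k"
    by (auto simp: k_def power2_eq_square algebra_simps intro: add_pos_nonneg)
  define h where "h = (- 1 / k) *\<^sub>R (star a * a)"
  have "star h = h"
    by (simp add: h_def star_minus star_scaleR star_mult)
  moreover have "norm h < 1"
    using k by (simp add: h_def cstar_identity)
  ultimately obtain b where b: "star b = b" "b * b = 1 + h"
    by (rule cstar_sqrt)
  have "0 \<le> Re (\<tau> (star (b * x) * (b * x)))"
    by (rule state_pos)
  also have "star (b * x) * (b * x) = star x * ((b * b) * x)"
    by (simp add: star_mult b(1) mult.assoc)
  also have "\<dots> = star x * x - (1 / k) *\<^sub>R (star (a * x) * (a * x))"
    by (simp add: b(2) h_def star_mult algebra_simps)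
  finally have "(gns_norm \<tau> (a * x))\<^sup>2 / k \<le> (gns_norm \<tau> x)\<^sup>2"
    by (simp add: state_diff state_scaleR gns_norm_power2)
  then show "(gns_norm \<tau> (a * x))\<^sup>2 \<le> ((norm a + 1) * gns_norm \<tau> x)\<^sup>2"
    using k by (simp add: power_mult_distrib k_def[symmetric] pos_divide_le_eq mult.commute)
qed (simp add: gns_norm_nonneg)

lemma gns_rel_equiv: "equiv (gns_cauchy \<tau>) (gns_rel \<tau>)"
proof (rule equivI)
  show "gns_rel \<tau> \<subseteq> gns_cauchy \<tau> \<times> gns_cauchy \<tau>"
    by (auto simp: gns_rel_def)
  show "refl_on (gns_cauchy \<tau>) (gns_rel \<tau>)"
    by (auto simp: gns_rel_def refl_on_def gns_norm_zero)
  show "sym (gns_rel \<tau>)"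
    by (auto simp: gns_rel_def sym_def gns_norm_diff_commute)
  show "trans (gns_rel \<tau>)"
  proof (rule transI)
    fix x y z
    assume xy: "(x, y) \<in> gns_rel \<tau>" and yz: "(y, z) \<in> gns_rel \<tau>"
    have "(\<lambda>n. gns_norm \<tau> (x n - z n)) \<longlonglongrightarrow> 0"
    proof (rule tendsto_sandwich[OF _ _ tendsto_const])
      show "(\<lambda>n. gns_norm \<tau> (x n - y n) + gns_norm \<tau> (y n - z n)) \<longlonglongrightarrow> 0"
        using xy yz by (auto simp: gns_rel_def intro: tendsto_add_zero)
      show "\<forall>\<^sub>F n in sequentially. gns_norm \<tau> (x n - z n) \<le>
              gns_norm \<tau> (x n - y n) + gns_norm \<tau> (y n - z n)"
        using gns_norm_triangle[of "x n - y n" "y n - z n" for n] by simp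
    qed (auto simp: gns_norm_nonneg)
    then show "(x, z) \<in> gns_rel \<tau>"
      using xy yz by (simp add: gns_rel_def)
  qed
qed

lemma gns_cauchy_mult:
  assumes "x \<in> gns_cauchy \<tau>"
  shows "(\<lambda>n. a * x n) \<in> gns_cauchy \<tau>"
  unfolding gns_cauchy_def
proof (intro CollectI allI impI)
  fix e :: real
  assume "e > 0"
  have pos: "norm a + 1 > 0"
    by (simp add: add_nonneg_pos)
  with \<open>e > 0\<close> have "e / (norm a + 1) > 0"
    by simp
  then obtain N where N: "\<forall>m\<ge>N. \<forall>n\<ge>N. gns_norm \<tau> (x m - x n) < e / (norm a + 1)"
    using assms unfolding gns_cauchy_def by blast
  have "gns_norm \<tau> (a * x m - a * x n) < e" if "m \<ge> N" "n \<ge> N" for m n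
  proof -
    have "gns_norm \<tau> (a * x m - a * x n) \<le> (norm a + 1) * gns_norm \<tau> (x m - x n)"
      using gns_norm_mult[of a "x m - x n"] by (simp add: right_diff_distrib)
    also have "\<dots> < e"
      using N that pos by (simp add: field_simps)
    finally show ?thesis .
  qed
  then show "\<exists>N. \<forall>m\<ge>N. \<forall>n\<ge>N. gns_norm \<tau> (a * x m - a * x n) < e"
    by blast
qed

lemma gns_rel_mult:
  assumes "(x, y) \<in> gns_rel \<tau>"
  shows "((\<lambda>n. a * x n), (\<lambda>n. a * y n)) \<in> gns_rel \<tau>"
proof -
  have "(\<lambda>n. gns_norm \<tau> (a * x n - a * y n)) \<longlonglongrightarrow> 0"
  proof (rule tendsto_sandwich[OF _ _ tendsto_const])
    show "(\<lambda>n. (norm a + 1) * gns_norm \<tau> (x n - y n)) \<longlonglongrightarrow> 0"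
      using assms by (auto simp: gns_rel_def intro: tendsto_mult_right_zero)
    show "\<forall>\<^sub>F n in sequentially. gns_norm \<tau> (a * x n - a * y n) \<le>
            (norm a + 1) * gns_norm \<tau> (x n - y n)"
      using gns_norm_mult[of a "x n - y n" for n] by (simp add: right_diff_distrib)
  qed (auto simp: gns_norm_nonneg)
  then show ?thesis
    using assms by (simp add: gns_rel_def gns_cauchy_mult)
qed

lemma gns_rep_class:
  assumes "x \<in> gns_cauchy \<tau>"
  shows "gns_rep \<tau> a (gns_rel \<tau> `` {x}) = gns_rel \<tau> `` {\<lambda>n. a * x n}"
proof -
  have "(\<lambda>x. gns_rel \<tau> `` {\<lambda>n. a * x n}) respects gns_rel \<tau>"
    by (auto intro!: congruentI equiv_class_eq[OF gns_rel_equiv] gns_rel_mult)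
  then show ?thesis
    using assms by (simp add: gns_rep_def gns_space_def quotientI UN_equiv_class[OF gns_rel_equiv])
qed

lemma gns_rep_in_space:
  assumes "X \<in> gns_space \<tau>"
  shows "gns_rep \<tau> a X \<in> gns_space \<tau>"
  using assms unfolding gns_space_def
  by (auto elim!: quotientE simp: gns_rep_class intro!: quotientI gns_cauchy_mult)

end

end

(*
A local unital positive map T, such as x |-> v* x v + w* x w with v, w local and v* v + w* w = 1,
can be applied independently at all sites 2hk, k an integer. This turns tau into a state phi
invariant under alpha^(2h), and by uniqueness the average of its translates is tau. For local x
this says that the sum over i of tau(T(alpha^i x)) - tau(x) vanishes. Comparing this identity for
T, for its translate by m, for the composition of the two, and for x* alpha^m(x), one obtains
  sum_i tau(w_i* alpha^m(w_i)) = 0   for all large m,   where w_i = T(alpha^i x) - alpha^i x,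
so by Cauchy-Schwarz applied to sums of widely separated translates of w_i every tau(w_i) is 0:
tau o T = tau. Unitary conjugations T show that tau is a trace. Taking v = c and
w = (1 - c* c)^(1/2) then gives tau(x [c, c*]) = 0 for all x, hence all commutators vanish in the
GNS representation.
*)

theory Submission
  imports Defs
begin

section \<open>States\<close>

text \<open>Square roots are the first obstacle: Kraus coefficients such as
  \<open>(1 - c* c)^(1/2)\<close> have to be local again, but a power series in an element of a
  non-closed subalgebra may leave it. So locality is measured by commutants. Whatever commutes with
  \<open>h\<close> commutes with the binomial series in \<open>h\<close>, hence the root stays in
  any set defined through bicommutants, and asymptotic commutation passes to bicommutants as well.
  The second obstacle is cancellation. Uniqueness controls only the sum over \<open>i\<close> of the
  defects \<open>\<tau> (T (A i x)) - \<tau> x\<close>, whose terms may have different signs.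
  Correlations at distance \<open>m\<close> turn these linear sums into quadratic ones, where
  positivity forbids cancellation. Locality also makes everything finite: a local element is moved
  by finitely many copies of \<open>T\<close>, so the infinite product of copies stabilises on
  \<open>B\<close> and the perturbed state is a plain pointwise limit.\<close>

lemma star_power: "star h = h \<Longrightarrow> star (h ^ n) = (h::'a::cstar_algebra_1) ^ n"
  by (induction n) (simp_all add: star_mult power_commutes)

text \<open>\<open>b\<close> is the binomial series in \<open>h\<close>; an element commuting with
  \<open>h\<close> commutes with each term and so with the sum. The last clause is what keeps roots
  local, and it makes \<open>b\<close> and \<open>h\<close> commute when unitaries are built from
  them.\<close>

lemma cstar_sqrt_commutant:
  fixes h :: "'a::cstar_algebra_1"
  assumes sa: "star h = h" and lt: "norm h < 1"
  obtains b where "star b = b" "b * b = 1 + h" "\<And>z. z * h = h * z \<Longrightarrow> z * b = b * z"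
proof -
  define f where "f n = ((1/2::real) gchoose n) *\<^sub>R h ^ n" for n
  define b where "b = (\<Sum>n. f n)"
  have "summable (\<lambda>n. norm (((1/2::real) gchoose n) * norm h ^ n))"
    using lt conv_radius_gchoose[of "1/2::real"]
    by (intro abs_summable_in_conv_radius) (auto split: if_splits)
  then have sm: "summable (\<lambda>n. norm (f n))"
    by (rule summable_comparison_test_ev[rotated])
       (auto simp: f_def abs_mult power_abs intro!: always_eventually mult_left_mono norm_power_ineq)
  note sf = summable_norm_cancel[OF sm]
  have 1: "star b = b"
    unfolding b_def using bounded_linear.suminf[OF bounded_linear_star sf]
    by (simp add: f_def [abs_def] star_scaleR star_power[OF sa])
  have conv: "(\<Sum>i\<le>n. f i * f (n - i)) = ((1::real) gchoose n) *\<^sub>R h ^ n" for n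
  proof -
    have "(\<Sum>i\<le>n. f i * f (n - i)) =
            (\<Sum>i\<le>n. (((1/2::real) gchoose i) * ((1/2) gchoose (n - i))) *\<^sub>R h ^ n)"
      by (intro sum.cong) (auto simp: f_def power_add[symmetric])
    then show ?thesis
      by (simp only: scaleR_sum_left[symmetric] gbinomial_half_convolution)
  qed
  have vanish: "(1::real) gchoose n = 0" if "n \<notin> {0, 1}" for n
  proof -
    have "(1::nat) choose n = 0"
      using that by (intro binomial_eq_0) auto
    then show ?thesis
      by (metis binomial_gbinomial of_nat_0 of_nat_1)
  qed
  have "(\<lambda>n. ((1::real) gchoose n) *\<^sub>R h ^ n) sums (b * b)"
    using Cauchy_product_sums[OF sm sm] by (simp only: conv b_def)
  moreover have "(\<lambda>n. ((1::real) gchoose n) *\<^sub>R h ^ n) sums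
                   (\<Sum>n\<in>{0, 1}. ((1::real) gchoose n) *\<^sub>R h ^ n)"
    by (rule sums_finite) (auto simp: vanish)
  ultimately have 2: "b * b = 1 + h"
    by (simp add: sums_unique2)
  have 3: "z * b = b * z" if "z * h = h * z" for z
  proof -
    have "z * f n = f n * z" for n
      using power_commuting_commutes[of h z n] that by (simp add: f_def)
    then show ?thesis
      using suminf_mult[OF sf, of z] suminf_mult2[OF sf, of z] by (simp add: b_def)
  qed
  show thesis
    using 1 2 3 by (rule that)
qed

text \<open>Scaling makes a bound sharp that is off by a fixed constant. It removes the
  \<open>+ 1\<close> of \<open>gns_norm_mult\<close>, and later the constant variance term in
  \<open>eq_0_of_correlations\<close>.\<close>

lemma norm_le_of_scaled:
  fixes a b c :: real
  assumes "\<And>n::nat. real n * a \<le> real n * b + c"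
  shows "a \<le> b"
proof (rule ccontr)
  assume "\<not> a \<le> b"
  then obtain n :: nat where "c < real n * (a - b)"
    using reals_Archimedean3[of "a - b"] by auto
  then show False
    using assms[of n] by (simp add: algebra_simps)
qed

lemma cmod_rotate:
  obtains c where "cmod c = 1" "c * z = complex_of_real (cmod z)"
proof (cases "z = 0")
  case False
  show thesis
  proof
    show "cmod (cnj z / of_real (cmod z)) = 1"
      using False by (simp add: norm_divide)
    show "cnj z / of_real (cmod z) * z = complex_of_real (cmod z)"
      using False complex_norm_square[of z]
      by (simp add: field_simps power2_eq_square)
  qed
qed (use that[of 1] in simp)

context
  fixes \<phi> :: "'a::cstar_algebra_1 \<Rightarrow> complex"
  assumes state: "is_state \<phi>"
begin

lemma state_one: "\<phi> 1 = 1"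
  using state by (simp add: is_state_def)

lemma state_zero: "\<phi> 0 = 0"
  using state_scaleC[OF state, of 0 0] by simp

lemma state_sum: "\<phi> (\<Sum>i\<in>I. f i) = (\<Sum>i\<in>I. \<phi> (f i))"
  by (induction I rule: infinite_finite_induct) (simp_all add: state_zero state_add[OF state])

lemma state_star: "\<phi> (star x) = cnj (\<phi> x)"
proof (rule complex_eqI)
  show "Re (\<phi> (star x)) = Re (cnj (\<phi> x))"
    using state_Re_sym[OF state, of x 1] by simp
  show "Im (\<phi> (star x)) = Im (cnj (\<phi> x))"
    using state_Re_sym[OF state, of "\<i> *\<^sub>C x" 1]
    by (simp add: star_scaleC state_scaleC[OF state] state_minus[OF state])
qed

text \<open>Cauchy-Schwarz against \<open>1\<close>. The available inequality bounds real parts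
  only, so \<open>x\<close> is first rotated by a phase that makes its value real and
  nonnegative.\<close>

lemma state_cmod_le_gns_norm: "cmod (\<phi> x) \<le> gns_norm \<phi> x"
proof -
  obtain c where c: "cmod c = 1" "c * \<phi> x = complex_of_real (cmod (\<phi> x))"
    by (rule cmod_rotate)
  have "cmod (\<phi> x) = Re (\<phi> (star 1 * (c *\<^sub>C x)))"
    using c by (simp add: state_scaleC[OF state])
  also have "\<dots> \<le> gns_norm \<phi> 1 * gns_norm \<phi> (c *\<^sub>C x)"
    using gns_cauchy_schwarz[OF state, of 1 "c *\<^sub>C x"] by linarith
  also have "gns_norm \<phi> 1 = 1"
    by (simp add: gns_norm_def state_one)
  also have "cnj c * c = 1"
    using c(1) complex_norm_square[of c] by (simp add: mult.commute)
  then have "gns_norm \<phi> (c *\<^sub>C x) = gns_norm \<phi> x"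
    by (simp add: gns_norm_def star_scaleC mult_scaleC_left mult_scaleC_right scaleC_scaleC
        mult.commute)
  finally show ?thesis
    by simp
qed

lemma state_cmod_le_norm: "cmod (\<phi> x) \<le> norm x"
proof (rule norm_le_of_scaled)
  fix n :: nat
  have "real n * cmod (\<phi> x) = cmod (\<phi> (real n *\<^sub>R x))"
    by (simp add: state_scaleR[OF state] norm_mult)
  also have "\<dots> \<le> gns_norm \<phi> (real n *\<^sub>R x * 1)"
    using state_cmod_le_gns_norm[of "real n *\<^sub>R x"] by simp
  also have "\<dots> \<le> (norm (real n *\<^sub>R x) + 1) * gns_norm \<phi> 1"
    by (rule gns_norm_mult[OF state])
  also have "gns_norm \<phi> 1 = 1"
    by (simp add: gns_norm_def state_one)
  finally show "real n * cmod (\<phi> x) \<le> real n * norm x + 1"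
    by simp
qed

lemma bounded_linear_state: "bounded_linear \<phi>"
  by (rule bounded_linear_intro[where K = 1])
     (auto simp: state_add[OF state] state_scaleR[OF state] scaleR_conv_of_real[where 'a = complex]
       state_cmod_le_norm)

lemmas continuous_state [continuous_intros] = bounded_linear.continuous_on[OF bounded_linear_state]

end

lemma is_stateI:
  assumes "\<And>x y. \<phi> (x + y) = \<phi> x + \<phi> y" "\<And>c x. \<phi> (c *\<^sub>C x) = c * \<phi> x"
    and "\<And>x. \<phi> (star x * x) \<in> \<real>\<^sub>\<ge>\<^sub>0" "\<phi> 1 = 1"
  shows "is_state \<phi>"
  using assms cvec.vector_space_axioms vector_space_over_itself.vector_space_axioms
  by (auto simp: is_state_def Vector_Spaces.linear_iff)

lemma state_nonneg: "is_state \<phi> \<Longrightarrow> \<phi> (star x * x) \<in> \<real>\<^sub>\<ge>\<^sub>0"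
  by (simp add: is_state_def)

lemma closed_eq_on_dense:
  assumes "continuous_on UNIV f" "continuous_on UNIV g" "closure B = UNIV"
    and "\<And>x. x \<in> B \<Longrightarrow> f x = (g x :: 'b::t2_space)"
  shows "f x = g x"
proof -
  have "closure B \<subseteq> {x. f x = g x}"
    using assms by (intro closure_minimal closed_Collect_eq) auto
  then show ?thesis
    using assms(3) by auto
qed

lemma states_eq_on_dense:
  assumes "is_state \<phi>" "is_state \<psi>" "closure B = UNIV" "\<And>x. x \<in> B \<Longrightarrow> \<phi> x = \<psi> x"
  shows "\<phi> x = \<psi> x"
  by (rule closed_eq_on_dense[OF _ _ assms(3,4)])
     (intro continuous_state assms continuous_on_id)+

text \<open>States are 1-Lipschitz, so an \<open>e / 4\<close> approximation from \<open>B\<close>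
  carries the Cauchy property to every element. No weak* compactness enters.\<close>

lemma state_limit:
  fixes \<phi> :: "nat \<Rightarrow> 'a::cstar_algebra_1 \<Rightarrow> complex"
  assumes st: "\<And>n. is_state (\<phi> n)" and dense: "closure B = UNIV"
    and conv: "\<And>x. x \<in> B \<Longrightarrow> convergent (\<lambda>n. \<phi> n x)"
  obtains \<psi> where "is_state \<psi>" "\<And>x. (\<lambda>n. \<phi> n x) \<longlonglongrightarrow> \<psi> x"
proof -
  have "Cauchy (\<lambda>n. \<phi> n x)" for x
  proof (rule metric_CauchyI)
    fix e :: real
    assume "e > 0"
    then obtain y where y: "y \<in> B" "dist y x < e / 4"
      using dense closure_approachable[of x B] by (metis UNIV_I divide_pos_pos zero_less_numeral)
    have "Cauchy (\<lambda>n. \<phi> n y)"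
      using conv[OF y(1)] by (rule convergent_Cauchy)
    then obtain N where N: "\<forall>m\<ge>N. \<forall>n\<ge>N. dist (\<phi> m y) (\<phi> n y) < e / 2"
      using \<open>e > 0\<close> by (meson half_gt_zero metric_CauchyD)
    have near: "dist (\<phi> n x) (\<phi> n y) < e / 4" for n
      using state_cmod_le_norm[OF st[of n], of "x - y"] y(2)
      by (simp add: state_diff[OF st] dist_norm norm_minus_commute)
    have "dist (\<phi> m x) (\<phi> n x) < e" if "m \<ge> N" "n \<ge> N" for m n
    proof -
      have "dist (\<phi> m y) (\<phi> n y) < e / 2"
        using N that by blast
      then show ?thesis
        using near[of m] near[of n] dist_triangle[of "\<phi> m x" "\<phi> n x" "\<phi> m y"]
          dist_triangle2[of "\<phi> m y" "\<phi> n x" "\<phi> n y"]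
        by linarith
    qed
    then show "\<exists>M. \<forall>m\<ge>M. \<forall>n\<ge>M. dist (\<phi> m x) (\<phi> n x) < e"
      by blast
  qed
  then obtain \<psi> where lim: "\<And>x. (\<lambda>n. \<phi> n x) \<longlonglongrightarrow> \<psi> x"
    unfolding Cauchy_convergent_iff convergent_def by metis
  have "is_state \<psi>"
  proof (rule is_stateI)
    show "\<psi> (x + y) = \<psi> x + \<psi> y" for x y
      using lim[of "x + y"] tendsto_add[OF lim[of x] lim[of y]]
      by (auto simp: state_add[OF st] intro: LIMSEQ_unique)
    show "\<psi> (c *\<^sub>C x) = c * \<psi> x" for c x
      using lim[of "c *\<^sub>C x"] tendsto_mult[OF tendsto_const lim[of x], of c]
      by (auto simp: state_scaleC[OF st] intro: LIMSEQ_unique)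
    show "\<psi> (star x * x) \<in> \<real>\<^sub>\<ge>\<^sub>0" for x
      by (rule closed_sequentially[OF closed_nonneg_Reals_complex _ lim]) (simp add: state_nonneg[OF st])
    show "\<psi> 1 = 1"
      using lim[of 1] by (simp add: state_one[OF st] LIMSEQ_const_iff)
  qed
  with lim show thesis
    using that by blast
qed

section \<open>Asymptotically abelian systems\<close>

locale star_action =
  fixes A :: "int \<Rightarrow> 'a::cstar_algebra_1 \<Rightarrow> 'a"
  assumes A_A: "A i (A j x) = A (i + j) x"
    and A_0 [simp]: "A 0 x = x"
    and A_add: "A j (x + y) = A j x + A j y"
    and A_scaleC: "A j (c *\<^sub>C x) = c *\<^sub>C A j x"
    and A_mult: "A j (x * y) = A j x * A j y"
    and A_star: "A j (star x) = star (A j x)"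
begin

lemma A_one [simp]: "A j 1 = 1"
  using A_mult[of j 1 "A (- j) 1"] by (simp add: A_A)

lemma A_diff: "A j (x - y) = A j x - A j y"
  using A_add[of j "x - y" y] by simp

end

locale asymp_abelian_system = star_action A for A :: "int \<Rightarrow> 'a::cstar_algebra_1 \<Rightarrow> 'a" +
  fixes B :: "'a set"
  assumes B_add: "x \<in> B \<Longrightarrow> y \<in> B \<Longrightarrow> x + y \<in> B"
    and B_mult: "x \<in> B \<Longrightarrow> y \<in> B \<Longrightarrow> x * y \<in> B"
    and B_scaleC: "x \<in> B \<Longrightarrow> c *\<^sub>C x \<in> B"
    and B_star: "x \<in> B \<Longrightarrow> star x \<in> B"
    and B_one: "1 \<in> B"
    and B_A: "x \<in> B \<Longrightarrow> A j x \<in> B"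
    and B_sqrt: "h \<in> B \<Longrightarrow> star h = h \<Longrightarrow> norm h < 1 \<Longrightarrow>
      \<exists>b\<in>B. star b = b \<and> b * b = 1 + h \<and> (\<forall>z. z * h = h * z \<longrightarrow> z * b = b * z)"
    and B_dense: "closure B = UNIV"
    and B_commute: "x \<in> B \<Longrightarrow> y \<in> B \<Longrightarrow> \<exists>p. \<forall>j. \<bar>j\<bar> \<ge> p \<longrightarrow> A j x * y = y * A j x"
begin

lemma B_diff: "x \<in> B \<Longrightarrow> y \<in> B \<Longrightarrow> x - y \<in> B"
  using B_add[OF _ B_scaleC[of y "-1"], of x] by (simp add: scaleC_minus1)

lemma B_minus: "x \<in> B \<Longrightarrow> - x \<in> B"
  using B_scaleC[of x "-1"] by (simp add: scaleC_minus1)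

lemma B_commute_finite:
  assumes "finite F" "finite G" "F \<subseteq> B" "G \<subseteq> B"
  shows "\<exists>p. \<forall>j. \<bar>j\<bar> \<ge> p \<longrightarrow> (\<forall>x\<in>F. \<forall>y\<in>G. A j x * y = y * A j x)"
proof -
  have "\<forall>x\<in>F. \<forall>y\<in>G. \<exists>p. \<forall>j. \<bar>j\<bar> \<ge> p \<longrightarrow> A j x * y = y * A j x"
    using assms B_commute by blast
  then obtain p where p: "\<And>x y j. x \<in> F \<Longrightarrow> y \<in> G \<Longrightarrow> \<bar>j\<bar> \<ge> p x y \<Longrightarrow> A j x * y = y * A j x"
    by metis
  define q where "q = Max (insert 0 ((\<lambda>(x, y). p x y) ` (F \<times> G)))"
  have "p x y \<le> q" if "x \<in> F" "y \<in> G" for x y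
    unfolding q_def using assms that by (intro Max_ge) auto
  then show ?thesis
    using p order_trans by metis
qed

lemma state_A: "is_state \<phi> \<Longrightarrow> is_state (\<lambda>x. \<phi> (A j x))"
  by (rule is_stateI)
     (simp_all add: A_add A_scaleC A_mult A_star state_add state_scaleC state_nonneg state_one)

section \<open>Local positive maps and their translates\<close>

definition shift :: "int \<Rightarrow> ('a \<Rightarrow> 'a) \<Rightarrow> 'a \<Rightarrow> 'a" where
  "shift j T x = A j (T (A (- j) x))"

text \<open>Positivity appears as pulling states back to states. The last two clauses say that
  \<open>T\<close> is a bimodule map over far translates of local elements and commutes with its own
  far copies. All clauses pass to \<open>T\<close> composed with a far copy, whereas the two-term
  Kraus form does not.\<close>

definition local_map :: "('a \<Rightarrow> 'a) \<Rightarrow> bool" where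
  "local_map T \<longleftrightarrow>
     (\<forall>\<phi>. is_state \<phi> \<longrightarrow> is_state (\<lambda>x. \<phi> (T x))) \<and>
     (\<forall>x y. T (x + y) = T x + T y) \<and> (\<forall>x. T (star x) = star (T x)) \<and> T 1 = 1 \<and>
     (\<forall>x\<in>B. T x \<in> B) \<and>
     (\<forall>x\<in>B. \<exists>p. \<forall>j. \<bar>j\<bar> \<ge> p \<longrightarrow>
        (\<forall>z. T (A j x * z) = A j x * T z \<and> T (z * A j x) = T z * A j x)) \<and>
     (\<exists>p. \<forall>j. \<bar>j\<bar> \<ge> p \<longrightarrow> (\<forall>z. T (shift j T z) = shift j T (T z)))"

lemma local_mapI:
  assumes "\<And>\<phi>. is_state \<phi> \<Longrightarrow> is_state (\<lambda>x. \<phi> (T x))"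
    and "\<And>x y. T (x + y) = T x + T y" "\<And>x. T (star x) = star (T x)" "T 1 = 1"
    and "\<And>x. x \<in> B \<Longrightarrow> T x \<in> B"
    and "\<And>x. x \<in> B \<Longrightarrow> \<exists>p. \<forall>j. \<bar>j\<bar> \<ge> p \<longrightarrow>
        (\<forall>z. T (A j x * z) = A j x * T z \<and> T (z * A j x) = T z * A j x)"
    and "\<exists>p. \<forall>j. \<bar>j\<bar> \<ge> p \<longrightarrow> (\<forall>z. T (shift j T z) = shift j T (T z))"
  shows "local_map T"
  using assms unfolding local_map_def by blast

context
  fixes T
  assumes T: "local_map T"
begin

lemma local_state: "is_state \<phi> \<Longrightarrow> is_state (\<lambda>x. \<phi> (T x))"
  and local_add: "T (x + y) = T x + T y"
  and local_star: "T (star x) = star (T x)"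
  and local_one: "T 1 = 1"
  and local_B: "x \<in> B \<Longrightarrow> T x \<in> B"
  using T by (auto simp: local_map_def)

lemma local_far:
  assumes "x \<in> B"
  obtains p where "\<And>j z. \<bar>j\<bar> \<ge> p \<Longrightarrow> T (A j x * z) = A j x * T z"
    "\<And>j z. \<bar>j\<bar> \<ge> p \<Longrightarrow> T (z * A j x) = T z * A j x"
  using T assms unfolding local_map_def by blast

lemma local_fix:
  assumes "x \<in> B"
  obtains q where "\<And>j. \<bar>j\<bar> \<ge> q \<Longrightarrow> T (A j x) = A j x"
  using local_far[OF assms] local_one by (metis mult.right_neutral)

lemma local_comm:
  obtains p where "\<And>j z. \<bar>j\<bar> \<ge> p \<Longrightarrow> T (shift j T z) = shift j T (T z)"
  using T unfolding local_map_def by blast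

lemma shift_state: "is_state \<phi> \<Longrightarrow> is_state (\<lambda>x. \<phi> (shift j T x))"
  unfolding shift_def using state_A[OF local_state[OF state_A]] by blast

lemma shift_local: "local_map (shift m T)"
proof (rule local_mapI)
  show "is_state (\<lambda>x. \<phi> (shift m T x))" if "is_state \<phi>" for \<phi>
    using that by (rule shift_state)
  show "\<exists>p. \<forall>j. \<bar>j\<bar> \<ge> p \<longrightarrow>
     (\<forall>z. shift m T (A j x * z) = A j x * shift m T z \<and> shift m T (z * A j x) = shift m T z * A j x)"
    if x: "x \<in> B" for x
  proof -
    obtain p where p: "\<And>j z. \<bar>j\<bar> \<ge> p \<Longrightarrow> T (A j x * z) = A j x * T z"
      "\<And>j z. \<bar>j\<bar> \<ge> p \<Longrightarrow> T (z * A j x) = T z * A j x"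
      using local_far[OF x] by blast
    have "shift m T (A j x * z) = A j x * shift m T z \<and> shift m T (z * A j x) = shift m T z * A j x"
      if "\<bar>j\<bar> \<ge> p + \<bar>m\<bar>" for j z
      using p[of "- m + j"] that by (simp add: shift_def A_mult A_A)
    then show ?thesis
      by blast
  qed
  obtain p where p: "\<And>j z. \<bar>j\<bar> \<ge> p \<Longrightarrow> T (shift j T z) = shift j T (T z)"
    using local_comm by blast
  have "shift m T (shift j (shift m T) z) = shift j (shift m T) (shift m T z)" if "\<bar>j\<bar> \<ge> p" for j z
    using p[OF that, of "A (- m) z"] by (simp add: shift_def A_A algebra_simps)
  then show "\<exists>p. \<forall>j. \<bar>j\<bar> \<ge> p \<longrightarrow>
      (\<forall>z. shift m T (shift j (shift m T) z) = shift j (shift m T) (shift m T z))"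
    by blast
qed (simp_all add: shift_def A_add local_add A_star local_star local_one local_B B_A)

text \<open>Allows the mean identity to be used for \<open>T\<close> acting at two sites at once,
  which is what produces correlations.\<close>

lemma local_pair:
  obtains p where "\<And>m. \<bar>m\<bar> \<ge> p \<Longrightarrow> local_map (\<lambda>x. T (shift m T x))"
proof -
  obtain p where p: "\<And>j z. \<bar>j\<bar> \<ge> p \<Longrightarrow> T (shift j T z) = shift j T (T z)"
    using local_comm by blast
  show thesis
  proof
    fix m
    assume m: "\<bar>m\<bar> \<ge> p"
    let ?S = "\<lambda>x. T (shift m T x)"
    show "local_map ?S"
    proof (rule local_mapI)
      show "is_state (\<lambda>x. \<phi> (?S x))" if "is_state \<phi>" for \<phi>
        using shift_state[OF local_state[OF that]] .
      show "\<exists>p. \<forall>j. \<bar>j\<bar> \<ge> p \<longrightarrow>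
          (\<forall>z. ?S (A j x * z) = A j x * ?S z \<and> ?S (z * A j x) = ?S z * A j x)"
        if x: "x \<in> B" for x
      proof -
        obtain q where q: "\<And>j z. \<bar>j\<bar> \<ge> q \<Longrightarrow> T (A j x * z) = A j x * T z"
          "\<And>j z. \<bar>j\<bar> \<ge> q \<Longrightarrow> T (z * A j x) = T z * A j x"
          using local_far[OF x] by blast
        have "?S (A j x * z) = A j x * ?S z \<and> ?S (z * A j x) = ?S z * A j x"
          if "\<bar>j\<bar> \<ge> q + \<bar>m\<bar>" for j z
          using q[of "- m + j"] q[of j] that by (simp add: shift_def A_mult A_A)
        then show ?thesis
          by blast
      qed
      have c: "shift i T (shift j T z) = shift j T (shift i T z)" if "\<bar>j - i\<bar> \<ge> p" for i j z
        using p[OF that, of "A (- i) z"] by (simp add: shift_def A_A algebra_simps)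
      have "shift j ?S z = shift j T (shift (j + m) T z)" for j z
        by (simp add: shift_def A_A algebra_simps)
      moreover have "T (shift j T z) = shift j T (T z)" if "\<bar>j\<bar> \<ge> p" for j z
        using c[of j 0 z] that by (simp add: shift_def)
      \<comment> \<open>The factors of the two maps sit at sites \<open>0\<close>, \<open>m\<close>
        and \<open>j\<close>, \<open>j + m\<close>. The threshold \<open>p + \<bar>m\<bar>\<close>
        keeps each of the differences \<open>j\<close>, \<open>j + m\<close>, \<open>j - m\<close>
        at absolute value at least \<open>p\<close>.\<close>
      ultimately have "?S (shift j ?S z) = shift j ?S (?S z)" if "\<bar>j\<bar> \<ge> p + \<bar>m\<bar>" for j z
        using that m by (simp add: c[of m "j + m"] c[of m j])
      then show "\<exists>p. \<forall>j. \<bar>j\<bar> \<ge> p \<longrightarrow> (\<forall>z. ?S (shift j ?S z) = shift j ?S (?S z))"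
        by blast
    qed (simp_all add: shift_def A_add local_add A_star local_star local_one local_B B_A)
  qed
qed

end

text \<open>On \<open>star x * x\<close> each term is again a square, of \<open>x * v\<close> or
  \<open>x * w\<close>. Locality holds because far translates commute with \<open>v\<close>,
  \<open>w\<close> and their adjoints.\<close>

lemma local_map_kraus:
  assumes v: "v \<in> B" and w: "w \<in> B" and one: "star v * v + star w * w = 1"
  shows "local_map (\<lambda>x. star v * x * v + star w * x * w)" (is "local_map ?T")
proof (rule local_mapI)
  fix \<phi> :: "'a \<Rightarrow> complex"
  assume \<phi>: "is_state \<phi>"
  show "is_state (\<lambda>x. \<phi> (?T x))"
  proof (rule is_stateI)
    show "\<phi> (?T (star x * x)) \<in> \<real>\<^sub>\<ge>\<^sub>0" for x
    proof -
      have "\<phi> (?T (star x * x)) = \<phi> (star (x * v) * (x * v)) + \<phi> (star (x * w) * (x * w))"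
        by (simp add: state_add[OF \<phi>] star_mult mult.assoc)
      then show ?thesis
        using nonneg_Reals_add_I[OF state_nonneg[OF \<phi>] state_nonneg[OF \<phi>]] by simp
    qed
    show "\<phi> (?T 1) = 1"
      using one by (simp add: state_one[OF \<phi>])
  qed (simp_all add: state_add[OF \<phi>] state_scaleC[OF \<phi>] mult_scaleC_left mult_scaleC_right
      distrib_left distrib_right)
next
  fix x
  assume "x \<in> B"
  then have "\<exists>p. \<forall>j. \<bar>j\<bar> \<ge> p \<longrightarrow> (\<forall>a\<in>{x}. \<forall>u\<in>{v, w, star v, star w}. A j a * u = u * A j a)"
    using v w B_star by (intro B_commute_finite) auto
  then obtain p where
    p: "\<And>j u. \<bar>j\<bar> \<ge> p \<Longrightarrow> u \<in> {v, w, star v, star w} \<Longrightarrow> A j x * u = u * A j x"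
    by (metis singletonI)
  have "?T (A j x * z) = A j x * ?T z \<and> ?T (z * A j x) = ?T z * A j x" if "\<bar>j\<bar> \<ge> p" for j z
  proof -
    have c: "u * (A j x * y) = A j x * (u * y)" if "u \<in> {v, w, star v, star w}" for u y
      using p[OF \<open>\<bar>j\<bar> \<ge> p\<close> that] by (metis mult.assoc)
    show ?thesis
      using p[OF that] by (simp add: c mult.assoc distrib_left distrib_right)
  qed
  then show "\<exists>p. \<forall>j. \<bar>j\<bar> \<ge> p \<longrightarrow>
      (\<forall>z. ?T (A j x * z) = A j x * ?T z \<and> ?T (z * A j x) = ?T z * A j x)"
    by blast
next
  let ?F = "{v, w, star v, star w}"
  have "\<exists>p. \<forall>j. \<bar>j\<bar> \<ge> p \<longrightarrow> (\<forall>a\<in>?F. \<forall>b\<in>?F. A j a * b = b * A j a)"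
    using v w B_star by (intro B_commute_finite) auto
  then obtain p where p: "\<And>j a b. \<bar>j\<bar> \<ge> p \<Longrightarrow> a \<in> ?F \<Longrightarrow> b \<in> ?F \<Longrightarrow> A j a * b = b * A j a"
    by blast
  have "?T (shift j ?T z) = shift j ?T (?T z)" if j: "\<bar>j\<bar> \<ge> p" for j z
  proof -
    have s: "shift j ?T z = A j (star v) * z * A j v + A j (star w) * z * A j w" for z
      by (simp add: shift_def A_add A_mult A_A)
    have c1: "A j a * b = b * A j a" if "a \<in> ?F" "b \<in> ?F" for a b
      using that by (rule p[OF j])
    have c: "A j a * (b * y) = b * (A j a * y)" if "a \<in> ?F" "b \<in> ?F" for a b y
      using p[OF j that] by (metis mult.assoc)
    show ?thesis
      unfolding s by (simp add: c c1 mult.assoc distrib_left distrib_right add_ac)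
  qed
  then show "\<exists>p. \<forall>j. \<bar>j\<bar> \<ge> p \<longrightarrow> (\<forall>z. ?T (shift j ?T z) = shift j ?T (?T z))"
    by blast
next
  show "?T (x + y) = ?T x + ?T y" for x y
    by (simp add: distrib_left distrib_right)
  show "?T (star x) = star (?T x)" for x
    by (simp add: star_add star_mult mult.assoc)
  show "?T x \<in> B" if "x \<in> B" for x
    using that v w by (intro B_add B_mult B_star)
qed (simp add: one)

section \<open>Averages of translates and infinite products of copies\<close>

lemma averaged_state:
  assumes \<phi>: "is_state \<phi>" and I: "finite I" "I \<noteq> {}"
  shows "is_state (\<lambda>x. (\<Sum>i\<in>I. \<phi> (A i x)) / of_nat (card I))"
proof (rule is_stateI)
  note st = state_A[OF \<phi>]
  show "(\<Sum>i\<in>I. \<phi> (A i (star x * x))) / of_nat (card I) \<in> \<real>\<^sub>\<ge>\<^sub>0" for x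
  proof -
    have "(\<Sum>i\<in>I. \<phi> (A i (star x * x))) \<in> \<real>\<^sub>\<ge>\<^sub>0"
      using I(1) by (induction I) (auto intro: nonneg_Reals_add_I state_nonneg[OF st])
    then show ?thesis
      by (simp add: nonneg_Reals_divide_I)
  qed
  show "(\<Sum>i\<in>I. \<phi> (A i 1)) / of_nat (card I) = 1"
    using I by (simp add: state_one[OF \<phi>])
qed (simp_all add: A_add A_scaleC state_add[OF \<phi>] state_scaleC[OF \<phi>] sum.distrib sum_distrib_left
    add_divide_distrib)

lemma sum_translate:
  fixes f :: "int \<Rightarrow> complex"
  assumes "a \<le> b" "f b = f a"
  shows "(\<Sum>i\<in>{a..<b}. f (i + 1)) = (\<Sum>i\<in>{a..<b}. f i)"
proof -
  have "(\<Sum>i\<in>{a..<b}. f (i + 1)) = (\<Sum>i\<in>{a + 1..<b + 1}. f i)"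
    by (rule sum.reindex_bij_witness[of _ "\<lambda>i. i - 1" "\<lambda>i. i + 1"]) auto
  also have "\<dots> = (\<Sum>i\<in>{a..<b}. f i)"
  proof (cases "a = b")
    case False
    with assms(1) have "{a + 1..<b + 1} = insert b {a + 1..<b}" "{a..<b} = insert a {a + 1..<b}"
      by auto
    then show ?thesis
      using assms(2) by simp
  qed simp
  finally show ?thesis .
qed

text \<open>The composition of the copies of \<open>T\<close> at the sites \<open>k * L\<close>. The
  fold is meaningful once these commute, which holds for \<open>L\<close> beyond the commutation
  range of \<open>T\<close>, since distinct sites are then at least \<open>L\<close> apart.\<close>

definition multi_shift :: "('a \<Rightarrow> 'a) \<Rightarrow> int \<Rightarrow> int set \<Rightarrow> 'a \<Rightarrow> 'a" where
  "multi_shift T L S x = Finite_Set.fold (\<lambda>k. shift (k * L) T) x S"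

context
  fixes T L p
  assumes T: "local_map T" and L: "L > 0" "L \<ge> p"
    and p: "\<And>j z. \<bar>j\<bar> \<ge> p \<Longrightarrow> T (shift j T z) = shift j T (T z)"
begin

lemma shift_comm: "shift (k * L) T (shift (l * L) T z) = shift (l * L) T (shift (k * L) T z)"
proof (cases "k = l")
  case False
  then have "1 * L \<le> \<bar>l - k\<bar> * L"
    using L by (intro mult_right_mono) auto
  moreover have "\<bar>l * L - k * L\<bar> = \<bar>l - k\<bar> * L"
    using L by (simp add: abs_mult left_diff_distrib[symmetric])
  ultimately have "\<bar>l * L - k * L\<bar> \<ge> p"
    using L by linarith
  from p[OF this, of "A (- (k * L)) z"] show ?thesis
    by (simp add: shift_def A_A algebra_simps)
qed simp

interpretation multi: comp_fun_commute "\<lambda>k. shift (k * L) T"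
  by standard (simp add: fun_eq_iff shift_comm)

lemma multi_empty [simp]: "multi_shift T L {} x = x"
  by (simp add: multi_shift_def)

lemma multi_insert:
  assumes "finite S" "k \<notin> S"
  shows "multi_shift T L (insert k S) x = shift (k * L) T (multi_shift T L S x)"
    and "multi_shift T L (insert k S) x = multi_shift T L S (shift (k * L) T x)"
  using assms by (simp_all add: multi_shift_def multi.fold_fun_left_comm)

lemma multi_state: "finite S \<Longrightarrow> is_state \<phi> \<Longrightarrow> is_state (\<lambda>x. \<phi> (multi_shift T L S x))"
proof (induction S arbitrary: \<phi> rule: finite_induct)
  case (insert k S)
  show ?case
    using insert.IH[OF shift_state[OF T insert.prems]] insert.hyps by (simp add: multi_insert(1))
qed simp

text \<open>Translation by \<open>L\<close> only renumbers the sites by one. This is the source of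
  the invariance of the limit state under \<open>A L\<close>.\<close>

lemma multi_translate:
  "finite S \<Longrightarrow> multi_shift T L ((\<lambda>k. k + 1) ` S) (A L x) = A L (multi_shift T L S x)"
proof (induction S rule: finite_induct)
  case (insert k S)
  then have "k + 1 \<notin> (\<lambda>k. k + 1) ` S"
    by auto
  then show ?case
    using insert by (simp add: multi_insert(1)) (simp add: shift_def A_A algebra_simps)
qed simp

text \<open>As the copies commute, those fixing \<open>x\<close> may be applied to it first, where
  they do nothing.\<close>

lemma multi_fix:
  assumes "finite S'" "\<And>k. k \<in> S' \<Longrightarrow> shift (k * L) T x = x" "S \<inter> S' = {}" "finite S"
  shows "multi_shift T L (S' \<union> S) x = multi_shift T L S x"
  using assms by (induction S' rule: finite_induct) (simp_all add: multi_insert(2))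

lemma shift_far_fix:
  assumes "\<And>j. \<bar>j\<bar> \<ge> q \<Longrightarrow> T (A j x) = A j x" "\<bar>i - k * L\<bar> \<ge> q"
  shows "shift (k * L) T (A i x) = A i x"
  using assms(1)[of "- (k * L) + i"] assms(2) by (simp add: shift_def A_A)

text \<open>A copy far from the origin fixes the local element \<open>x\<close>, so enlarging the
  window of sites beyond its range changes nothing.\<close>

lemma multi_eventually:
  assumes x: "x \<in> B"
  obtains N where "N \<ge> 0" "\<And>S. finite S \<Longrightarrow> {-N..N} \<subseteq> S \<Longrightarrow> multi_shift T L S x = multi_shift T L {-N..N} x"
proof -
  obtain q where q: "\<And>j. \<bar>j\<bar> \<ge> q \<Longrightarrow> T (A j x) = A j x"
    using local_fix[OF T x] by blast
  show thesis
  proof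
    fix S
    assume S: "finite S" "{-\<bar>q\<bar>..\<bar>q\<bar>} \<subseteq> S"
    have "shift (k * L) T x = x" if "k \<in> S - {-\<bar>q\<bar>..\<bar>q\<bar>}" for k
    proof -
      have "\<bar>k\<bar> * 1 \<le> \<bar>k\<bar> * L"
        using L by (intro mult_left_mono) auto
      then have "\<bar>0 - k * L\<bar> \<ge> q"
        using that L by (auto simp: abs_mult)
      with q have "shift (k * L) T (A 0 x) = A 0 x"
        by (rule shift_far_fix)
      then show ?thesis
        by simp
    qed
    then have "multi_shift T L ((S - {-\<bar>q\<bar>..\<bar>q\<bar>}) \<union> {-\<bar>q\<bar>..\<bar>q\<bar>}) x = multi_shift T L {-\<bar>q\<bar>..\<bar>q\<bar>} x"
      using S by (intro multi_fix) auto
    moreover have "(S - {-\<bar>q\<bar>..\<bar>q\<bar>}) \<union> {-\<bar>q\<bar>..\<bar>q\<bar>} = S"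
      using S by auto
    ultimately show "multi_shift T L S x = multi_shift T L {-\<bar>q\<bar>..\<bar>q\<bar>} x"
      by simp
  qed simp
qed

text \<open>\<open>\<phi>\<close> is \<open>\<tau>\<close> composed with the product of all copies,
  the limit over growing windows of sites. The last clause computes it where only the copy at site 0
  acts.\<close>

lemma perturbed_state:
  assumes \<tau>: "is_state \<tau>" and inv: "\<And>j x. \<tau> (A j x) = \<tau> x"
  shows "\<exists>\<phi>. is_state \<phi> \<and> (\<forall>x. \<phi> (A L x) = \<phi> x) \<and>
    (\<forall>x. (\<forall>k. k \<noteq> 0 \<longrightarrow> shift (k * L) T x = x) \<longrightarrow> \<phi> x = \<tau> (T x))"
proof -
  define \<phi>' where "\<phi>' n x = \<tau> (multi_shift T L {- int n..int n} x)" for n x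
  have st: "is_state (\<phi>' n)" for n
    unfolding \<phi>'_def using multi_state[OF _ \<tau>] by simp
  have ev: "\<exists>N c. (\<forall>n\<ge>N. \<phi>' n x = c \<and> \<phi>' n (A L x) = c)" if x: "x \<in> B" for x
  proof -
    obtain N where N: "N \<ge> 0"
      "\<And>S. finite S \<Longrightarrow> {-N..N} \<subseteq> S \<Longrightarrow> multi_shift T L S x = multi_shift T L {-N..N} x"
      using multi_eventually[OF x] by blast
    let ?c = "\<tau> (multi_shift T L {-N..N} x)"
    \<comment> \<open>The \<open>+ 1\<close> leaves room for the window
      \<open>{- int n - 1..int n - 1}\<close>, displaced by translation, to contain
      \<open>{-N..N}\<close> too.\<close>
    have "\<phi>' n x = ?c \<and> \<phi>' n (A L x) = ?c" if n: "n \<ge> nat (N + 1)" for n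
    proof
      have sub: "{-N..N} \<subseteq> {- int n..int n}" "{-N..N} \<subseteq> {- int n - 1..int n - 1}"
        using n N(1) by auto
      show "\<phi>' n x = ?c"
        using N(2)[OF _ sub(1)] by (simp add: \<phi>'_def)
      have "{- int n..int n} = (\<lambda>k. k + 1) ` {- int n - 1..int n - 1}"
        by (simp add: image_add_atLeastAtMost')
      then have "multi_shift T L {- int n..int n} (A L x) = A L (multi_shift T L {- int n - 1..int n - 1} x)"
        using multi_translate[of "{- int n - 1..int n - 1}" x] by simp
      then show "\<phi>' n (A L x) = ?c"
        using N(2)[OF _ sub(2)] by (simp add: \<phi>'_def inv)
    qed
    then show ?thesis
      by blast
  qed
  have "convergent (\<lambda>n. \<phi>' n x)" if "x \<in> B" for x
  proof -
    obtain N c where "\<forall>n\<ge>N. \<phi>' n x = c \<and> \<phi>' n (A L x) = c"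
      using ev[OF \<open>x \<in> B\<close>] by blast
    then have "\<forall>\<^sub>F n in sequentially. \<phi>' n x = c"
      unfolding eventually_sequentially by blast
    then show ?thesis
      by (auto intro: convergentI tendsto_eventually)
  qed
  then obtain \<phi> where \<phi>: "is_state \<phi>" "\<And>x. (\<lambda>n. \<phi>' n x) \<longlonglongrightarrow> \<phi> x"
    using state_limit[of \<phi>', OF st B_dense] by blast
  have "\<phi> (A L x) = \<phi> x" if "x \<in> B" for x
  proof -
    obtain N c where "\<forall>n\<ge>N. \<phi>' n x = c \<and> \<phi>' n (A L x) = c"
      using ev[OF \<open>x \<in> B\<close>] by blast
    then have "\<forall>\<^sub>F n in sequentially. \<phi>' n (A L x) = \<phi>' n x"
      unfolding eventually_sequentially by metis
    then have "(\<lambda>n. \<phi>' n x) \<longlonglongrightarrow> \<phi> (A L x)"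
      by (rule Lim_transform_eventually[OF \<phi>(2)])
    then show ?thesis
      by (rule LIMSEQ_unique[OF _ \<phi>(2)])
  qed
  then have "\<phi> (A L x) = \<phi> x" for x
    by (rule states_eq_on_dense[OF state_A[OF \<phi>(1)] \<phi>(1) B_dense])
  moreover have "\<phi> x = \<tau> (T x)" if far: "\<forall>k. k \<noteq> 0 \<longrightarrow> shift (k * L) T x = x" for x
  proof -
    have "\<phi>' n x = \<tau> (T x)" for n
    proof -
      have "multi_shift T L (({- int n..int n} - {0}) \<union> {0}) x = multi_shift T L {0} x"
        using far by (intro multi_fix) auto
      also have "({- int n..int n} - {0}) \<union> {0} = {- int n..int n}"
        by auto
      also have "multi_shift T L {0} x = T x"
        by (simp add: multi_insert(1)) (simp add: shift_def)
      finally show ?thesis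
        by (simp add: \<phi>'_def)
    qed
    then show ?thesis
      using \<phi>(2)[of x] by (simp add: LIMSEQ_const_iff)
  qed
  ultimately show ?thesis
    using \<phi>(1) by blast
qed

end

end

section \<open>Consequences of a unique invariant state\<close>

locale uniquely_ergodic_system = asymp_abelian_system +
  fixes \<tau> :: "'a \<Rightarrow> complex"
  assumes state: "is_state \<tau>" and inv1: "\<tau> (A 1 x) = \<tau> x"
    and unique: "is_state \<sigma> \<Longrightarrow> (\<And>x. \<sigma> (A 1 x) = \<sigma> x) \<Longrightarrow> \<sigma> = \<tau>"
begin

lemma inv: "\<tau> (A j x) = \<tau> x"
proof (induction j rule: int_induct[of _ 0])
  case (step1 i)
  then show ?case
    using inv1[of "A i x"] by (simp add: A_A add.commute)
next
  case (step2 i)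
  then show ?case
    using inv1[of "A (i - 1) x"] by (simp add: A_A)
qed simp

text \<open>
  Applying \<open>T\<close> at all sites \<open>2 * h * k\<close> to \<open>\<tau>\<close> gives a state \<open>\<phi>\<close> invariant under
  \<open>A (2 * h)\<close>; the average of its translates is invariant, hence equal to \<open>\<tau>\<close>.
\<close>

lemma local_mean:
  assumes T: "local_map T" and x: "x \<in> B"
  obtains h0 where "\<And>h. h \<ge> h0 \<Longrightarrow> (\<Sum>i\<in>{-h..<h}. \<tau> (T (A i x)) - \<tau> x) = 0"
proof -
  obtain p where p: "\<And>j z. \<bar>j\<bar> \<ge> p \<Longrightarrow> T (shift j T z) = shift j T (T z)"
    using local_comm[OF T] by blast
  obtain q where q: "\<And>j. \<bar>j\<bar> \<ge> q \<Longrightarrow> T (A j x) = A j x"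
    using local_fix[OF T x] by blast
  show thesis
  proof
    fix h
    \<comment> \<open>\<open>2 * h \<ge> p\<close> makes the copies commute. For \<open>i\<close> in
      \<open>{-h..<h}\<close> and \<open>k \<noteq> 0\<close> the site \<open>2 * h * k\<close> is
      at distance at least \<open>h \<ge> q\<close> from \<open>i\<close>, so only the copy at 0
      touches \<open>A i x\<close>.\<close>
    assume h: "h \<ge> max 1 (max p q)"
    then have h': "0 < 2 * h" "p \<le> 2 * h"
      by auto
    obtain \<phi> where \<phi>: "is_state \<phi>" "\<forall>x. \<phi> (A (2 * h) x) = \<phi> x"
      "\<forall>x. (\<forall>k. k \<noteq> 0 \<longrightarrow> shift (k * (2 * h)) T x = x) \<longrightarrow> \<phi> x = \<tau> (T x)"
    proof -
      have "\<exists>\<phi>. is_state \<phi> \<and> (\<forall>x. \<phi> (A (2 * h) x) = \<phi> x) \<and>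
          (\<forall>x. (\<forall>k. k \<noteq> 0 \<longrightarrow> shift (k * (2 * h)) T x = x) \<longrightarrow> \<phi> x = \<tau> (T x))"
        by (rule perturbed_state[OF T h' _ state inv]) (rule p)
      then show thesis
        using that by (elim exE conjE)
    qed
    define \<psi> where "\<psi> x = (\<Sum>i\<in>{-h..<h}. \<phi> (A i x)) / of_nat (card {-h..<h})" for x
    have "is_state \<psi>"
      using averaged_state[OF \<phi>(1), of "{-h..<h}"] h unfolding \<psi>_def[abs_def] by auto
    \<comment> \<open>The half-open window is exactly one period \<open>2 * h\<close> of
      \<open>\<phi>\<close>: moving it by one replaces the term at \<open>-h\<close> by the equal
      term at \<open>h\<close>.\<close>
    moreover have "\<psi> (A 1 x) = \<psi> x" for x
    proof -
      have "\<phi> (A h x) = \<phi> (A (- h) x)"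
        using \<phi>(2)[rule_format, of "A (- h) x"] by (simp add: A_A)
      then show ?thesis
        using sum_translate[of "- h" h "\<lambda>i. \<phi> (A i x)"] h by (simp add: \<psi>_def A_A)
    qed
    ultimately have "\<psi> = \<tau>"
      by (rule unique)
    then have "\<tau> x = (\<Sum>i\<in>{-h..<h}. \<phi> (A i x)) / of_nat (card {-h..<h})"
      using \<psi>_def[of x] by simp
    moreover have "\<phi> (A i x) = \<tau> (T (A i x))" if i: "i \<in> {-h..<h}" for i
    proof (rule \<phi>(3)[THEN spec, THEN mp], intro allI impI)
      fix k :: int
      assume "k \<noteq> 0"
      then have "1 * (2 * h) \<le> \<bar>k\<bar> * (2 * h)"
        using h by (intro mult_right_mono) auto
      then have "2 * h \<le> \<bar>k * (2 * h)\<bar>"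
        using h by (simp add: abs_mult)
      then have "\<bar>- (k * (2 * h)) + i\<bar> \<ge> q"
        using i h by auto
      then show "shift (k * (2 * h)) T (A i x) = A i x"
        using q[of "- (k * (2 * h)) + i"] by (simp add: shift_def A_A)
    qed
    ultimately show "(\<Sum>i\<in>{-h..<h}. \<tau> (T (A i x)) - \<tau> x) = 0"
      using h by (simp add: sum_subtractf field_simps)
  qed
qed

text \<open>A law of large numbers: for the sum of \<open>K\<close> uncorrelated translates the
  second moment grows like \<open>K\<close>, the squared mean like \<open>K^2\<close>. All indices
  in \<open>I\<close> are summed together because only their total correlation is known to
  vanish.\<close>

lemma eq_0_of_correlations:
  fixes w :: "int \<Rightarrow> 'a"
  assumes I: "finite I" and M: "M > 0"
    and z: "\<And>m. m \<ge> M \<Longrightarrow> (\<Sum>i\<in>I. \<tau> (star (w i) * A m (w i))) = 0"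
    and i: "i \<in> I"
  shows "\<tau> (w i) = 0"
proof -
  define G where "G m = (\<Sum>i\<in>I. \<tau> (star (w i) * A m (w i)))" for m
  define Z where "Z K i = (\<Sum>k<K. A (int k * M) (w i))" for K i
  have G: "(\<Sum>i\<in>I. \<tau> (star (A k (w i)) * A l (w i))) = G (l - k)" for k l
  proof -
    have "star (A k (w i)) * A l (w i) = A k (star (w i) * A (l - k) (w i))" for i
      by (simp add: A_mult A_star A_A)
    then show ?thesis
      by (simp add: G_def inv)
  qed
  \<comment> \<open>The hypothesis concerns \<open>m \<ge> M\<close> only; conjugation supplies the
    negative distances.\<close>
  have cnj: "G (- m) = cnj (G m)" for m
  proof -
    have "\<tau> (star (w i) * A (- m) (w i)) = cnj (\<tau> (star (w i) * A m (w i)))" for i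
      using inv[of m "star (w i) * A (- m) (w i)"]
      by (simp add: state_star[OF state, symmetric] star_mult A_mult A_star A_A)
    then show ?thesis
      by (simp add: G_def)
  qed
  have G0: "G (int l * M - int k * M) = (if l = k then G 0 else 0)" for k l :: nat
  proof -
    have pos: "G (int l * M - int k * M) = 0" if "k < l" for k l :: nat
    proof -
      have "1 * M \<le> (int l - int k) * M"
        using that M by (intro mult_right_mono) auto
      then show ?thesis
        using z[of "int l * M - int k * M"] by (simp add: G_def left_diff_distrib)
    qed
    have "G (int l * M - int k * M) = 0" if "l < k"
      using pos[OF that] cnj[of "int k * M - int l * M"] by simp
    with pos[of k l] show ?thesis
      by (cases l k rule: linorder_cases) auto
  qed
  have sumZ: "(\<Sum>i\<in>I. \<tau> (star (Z K i) * Z K i)) = of_nat K * G 0" for K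
  proof -
    have star_sum: "star (Z K i) = (\<Sum>k<K. star (A (int k * M) (w i)))" for i
      unfolding Z_def using linear_sum[OF bounded_linear.linear[OF bounded_linear_star]] by simp
    have "(\<Sum>i\<in>I. \<tau> (star (Z K i) * Z K i)) =
        (\<Sum>i\<in>I. \<Sum>k<K. \<Sum>l<K. \<tau> (star (A (int k * M) (w i)) * A (int l * M) (w i)))"
      unfolding star_sum by (simp add: Z_def sum_product state_sum[OF state])
    also have "\<dots> = (\<Sum>k<K. \<Sum>i\<in>I. \<Sum>l<K. \<tau> (star (A (int k * M) (w i)) * A (int l * M) (w i)))"
      by (rule sum.swap)
    also have "\<dots> = (\<Sum>k<K. \<Sum>l<K. \<Sum>i\<in>I. \<tau> (star (A (int k * M) (w i)) * A (int l * M) (w i)))"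
      by (intro sum.cong refl sum.swap)
    also have "\<dots> = (\<Sum>k<K. \<Sum>l<K. if l = k then G 0 else 0)"
      by (simp add: G G0)
    also have "\<dots> = of_nat K * G 0"
      by simp
    finally show ?thesis .
  qed
  have "real n * (cmod (\<tau> (w i)))\<^sup>2 \<le> real n * 0 + Re (G 0)" for n
  proof (cases "n = 0")
    \<comment> \<open>For \<open>n = 0\<close> the claim is \<open>Re (G 0) \<ge> 0\<close>, and
      \<open>G 0\<close> is a sum of values of \<open>\<tau>\<close> at squares.\<close>
    case True
    show ?thesis
      using True z sumZ[of 1] by (auto simp: Z_def intro!: sum_nonneg state_pos[OF state] simp: G_def)
  next
    case False
    have "\<tau> (Z n i) = of_nat n * \<tau> (w i)"
      by (simp add: Z_def state_sum[OF state] inv)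
    then have "(real n)\<^sup>2 * (cmod (\<tau> (w i)))\<^sup>2 = (cmod (\<tau> (Z n i)))\<^sup>2"
      by (simp add: norm_mult power_mult_distrib)
    also have "\<dots> \<le> (gns_norm \<tau> (Z n i))\<^sup>2"
      by (intro power_mono state_cmod_le_gns_norm[OF state]) simp
    also have "\<dots> = Re (\<tau> (star (Z n i) * Z n i))"
      by (rule gns_norm_power2[OF state])
    also have "\<dots> \<le> (\<Sum>i\<in>I. Re (\<tau> (star (Z n i) * Z n i)))"
      by (intro member_le_sum[OF i] I state_pos[OF state])
    also have "\<dots> = Re (\<Sum>i\<in>I. \<tau> (star (Z n i) * Z n i))"
      by simp
    also have "\<dots> = real n * Re (G 0)"
      by (simp add: sumZ)
    finally show ?thesis
      using False by (simp add: power2_eq_square mult.assoc)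
  qed
  then have "(cmod (\<tau> (w i)))\<^sup>2 \<le> 0"
    by (rule norm_le_of_scaled)
  then show ?thesis
    by simp
qed

text \<open>
  Comparing the effect of \<open>T\<close> applied at site 0, at site \<open>m\<close> and at both sites on
  \<open>star x * A m x\<close> isolates the correlations of the \<open>w i\<close>.
\<close>

lemma local_invariant:
  assumes T: "local_map T" and x: "x \<in> B"
  shows "\<tau> (T x) = \<tau> x"
proof -
  define w where "w i = T (A i x) - A i x" for i
  obtain p1 where p1: "\<And>j z. \<bar>j\<bar> \<ge> p1 \<Longrightarrow> T (A j x * z) = A j x * T z"
    "\<And>j z. \<bar>j\<bar> \<ge> p1 \<Longrightarrow> T (z * A j x) = T z * A j x"
    using local_far[OF T x] by blast
  obtain p2 where p2: "\<And>j z. \<bar>j\<bar> \<ge> p2 \<Longrightarrow> T (A j (star x) * z) = A j (star x) * T z"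
    "\<And>j z. \<bar>j\<bar> \<ge> p2 \<Longrightarrow> T (z * A j (star x)) = T z * A j (star x)"
    using local_far[OF T B_star[OF x]] by blast
  obtain p3 where p3: "\<And>m. \<bar>m\<bar> \<ge> p3 \<Longrightarrow> local_map (\<lambda>x. T (shift m T x))"
    using local_pair[OF T] by blast
  obtain p4 where p4: "\<And>j z. \<bar>j\<bar> \<ge> p4 \<Longrightarrow> T (shift j T z) = shift j T (T z)"
    using local_comm[OF T] by blast
  \<comment> \<open>The range of \<open>T (A i x)\<close> depends on \<open>i\<close>; only the
    finitely many \<open>i\<close> in \<open>{-p..<p}\<close> will enter \<open>M\<close>.\<close>
  have "\<forall>i. \<exists>q. \<forall>j. \<bar>j\<bar> \<ge> q \<longrightarrow> (\<forall>z. T (z * A j (T (A i x))) = T z * A j (T (A i x)))"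
    using local_far[OF T local_B[OF T B_A[OF x]]] by metis
  then obtain q where q: "\<And>i j z. \<bar>j\<bar> \<ge> q i \<Longrightarrow> T (z * A j (T (A i x))) = T z * A j (T (A i x))"
    by metis
  \<comment> \<open>The 1 puts the index \<open>0\<close>, used at the end, into
    \<open>{-p..<p}\<close>.\<close>
  define p where "p = max 1 (max p1 p2)"
  \<comment> \<open>Beyond \<open>p3\<close> the two-site map is local, beyond \<open>p4\<close> its
    factors commute, and \<open>4 * p\<close> separates the neighbourhoods of the sites
    \<open>0\<close>, \<open>m\<close> and \<open>2 * m\<close>.\<close>
  define M where "M = Max (insert p3 (insert p4 (insert (4 * p) (q ` {-p..<p}))))"
  have p: "p \<ge> 1" "p \<ge> p1" "p \<ge> p2"
    by (auto simp: p_def)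
  have M: "M \<ge> p3" "M \<ge> p4" "M \<ge> 4 * p"
    unfolding M_def by (intro Max_ge; simp)+
  have Mq: "M \<ge> q i" if "i \<in> {-p..<p}" for i
    unfolding M_def using that by (intro Max_ge) auto
  have Tfix: "T (A i x) = A i x" "T (A i (star x)) = A i (star x)" if "\<bar>i\<bar> \<ge> p" for i
    using p1(1)[of i 1] p2(1)[of i 1] that p by (simp_all add: local_one[OF T])
  have cor: "(\<Sum>i\<in>{-p..<p}. \<tau> (star (w i) * A m (w i))) = 0" if m: "m \<ge> M" for m
  proof -
    \<comment> \<open>\<open>D\<close> is \<open>T - 1\<close> composed with
      \<open>shift m T - 1\<close>, expanded so that each term is covered by
      \<open>local_mean\<close>.\<close>
    define D where "D z = T (shift m T z) - T z - shift m T z + z" for z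
    let ?y = "star x * A m x"
    have y: "?y \<in> B"
      using x by (intro B_mult B_star B_A)
    have "local_map (\<lambda>x. T (shift m T x))"
      using p3 m M by simp
    then obtain h1 where h1: "\<And>h. h \<ge> h1 \<Longrightarrow> (\<Sum>i\<in>{-h..<h}. \<tau> (T (shift m T (A i ?y))) - \<tau> ?y) = 0"
      using local_mean[OF _ y] by blast
    obtain h2 where h2: "\<And>h. h \<ge> h2 \<Longrightarrow> (\<Sum>i\<in>{-h..<h}. \<tau> (T (A i ?y)) - \<tau> ?y) = 0"
      using local_mean[OF T y] by blast
    obtain h3 where h3: "\<And>h. h \<ge> h3 \<Longrightarrow> (\<Sum>i\<in>{-h..<h}. \<tau> (shift m T (A i ?y)) - \<tau> ?y) = 0"
      using local_mean[OF shift_local[OF T] y] by blast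
    define h where "h = max p (max h1 (max h2 h3))"
    have "(\<Sum>i\<in>{-h..<h}. \<tau> (D (A i ?y))) =
        (\<Sum>i\<in>{-h..<h}. \<tau> (T (shift m T (A i ?y))) - \<tau> ?y) -
        (\<Sum>i\<in>{-h..<h}. \<tau> (T (A i ?y)) - \<tau> ?y) - (\<Sum>i\<in>{-h..<h}. \<tau> (shift m T (A i ?y)) - \<tau> ?y)"
      unfolding sum_subtractf[symmetric]
      by (intro sum.cong) (simp_all add: D_def state_add[OF state] state_diff[OF state] inv)
    also have "\<dots> = 0"
      using h1[of h] h2[of h] h3[of h] by (simp add: h_def)
    finally have sum0: "(\<Sum>i\<in>{-h..<h}. \<tau> (D (A i ?y))) = 0" .
    \<comment> \<open>Near the origin \<open>T\<close> acts only on the left factor and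
      \<open>shift m T\<close> only on the right one, so \<open>D\<close> factorises.\<close>
    have near: "D (A i ?y) = star (w i) * A m (w i)" if i: "i \<in> {-p..<p}" for i
    proof -
      let ?a = "A i (star x)" and ?b = "A (i + m) x" and ?c = "A m (T (A i x))"
      have b: "shift m T ?b = ?c"
        by (simp add: shift_def A_A)
      have "\<bar>- m + i\<bar> \<ge> p2"
        using i p m M by auto
      then have a: "shift m T (?a * z) = ?a * shift m T z" for z
        using p2(1)[of "- m + i" "A (- m) z"] by (simp add: shift_def A_mult A_A)
      have Tb: "T (z * ?b) = T z * ?b" for z
        using i p m M by (intro p1) auto
      have Tc: "T (z * ?c) = T z * ?c" for z
        using q[of i m z] Mq[OF i] m M p by simp
      have "D (A i ?y) = T ?a * ?c - T ?a * ?b - ?a * ?c + ?a * ?b"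
        by (simp add: D_def A_mult A_A a b Tb Tc)
      also have "\<dots> = (T ?a - ?a) * (?c - ?b)"
        by (simp add: algebra_simps)
      also have "\<dots> = star (w i) * A m (w i)"
        by (simp add: w_def star_diff A_diff A_A A_star local_star[OF T] add.commute)
      finally show ?thesis .
    qed
    have far: "D (A i ?y) = 0" if i: "\<bar>i\<bar> \<ge> p" for i
    proof -
      let ?a = "A i (star x)" and ?b = "A (i + m) x"
      show ?thesis
      \<comment> \<open>If \<open>i\<close> is also far from \<open>m\<close>, then
        \<open>shift m T\<close> fixes both factors of \<open>A i ?y\<close>. Otherwise the factors
        sit near \<open>m\<close> and \<open>2 * m\<close>, both out of reach of \<open>T\<close>,
        and commuting the two maps shows that \<open>D\<close> vanishes again.\<close>
      proof (cases "\<bar>- m + i\<bar> \<ge> p")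
        case True
        then have a: "shift m T (?a * z) = ?a * shift m T z" for z
          using p2(1)[of "- m + i" "A (- m) z"] p by (simp add: shift_def A_mult A_A)
        have Ta: "T (?a * z) = ?a * T z" for z
          using i p by (intro p2) auto
        have b: "shift m T ?b = ?b"
          using Tfix(1)[OF i] by (simp add: shift_def A_A add.commute)
        show ?thesis
          by (simp add: D_def A_mult A_A a Ta b)
      next
        case False
        have Tb: "T (z * ?b) = T z * ?b" for z
          using False i p m M by (intro p1) auto
        have b: "shift m T (z * ?b) = shift m T z * ?b" for z
          using p1(2)[of i "A (- m) z"] i p by (simp add: shift_def A_mult A_A add.commute)
        have "T (shift m T ?a) = shift m T ?a"
          using p4[of m ?a] m M p Tfix(2)[OF i] by simp
        then show ?thesis
          by (simp add: D_def A_mult A_A Tb b Tfix(2)[OF i])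
      qed
    qed
    have "(\<Sum>i\<in>{-h..<h}. \<tau> (D (A i ?y))) = (\<Sum>i\<in>{-p..<p}. \<tau> (D (A i ?y)))"
      using far by (intro sum.mono_neutral_right) (auto simp: h_def state_zero[OF state])
    also have "\<dots> = (\<Sum>i\<in>{-p..<p}. \<tau> (star (w i) * A m (w i)))"
      by (intro sum.cong) (simp_all add: near)
    finally show ?thesis
      using sum0 by simp
  qed
  have "\<tau> (w 0) = 0"
    by (rule eq_0_of_correlations[OF _ _ cor]) (use p M in auto)
  then show ?thesis
    by (simp add: w_def state_diff[OF state])
qed

section \<open>The trace property\<close>

lemma trace_selfadjoint:
  assumes h: "h \<in> B" "star h = h" "norm h < 1" and x: "x \<in> B"
  shows "\<tau> (h * x) = \<tau> (x * h)"
proof -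
  have "norm (- (h * h)) < 1"
    using h(3) cstar_identity[of h] by (simp add: h(2) power_less_one_iff)
  moreover have "star (- (h * h)) = - (h * h)"
    by (simp add: star_minus star_mult h(2))
  ultimately obtain b where b: "b \<in> B" "star b = b" "b * b = 1 + - (h * h)"
      "\<forall>z. z * - (h * h) = - (h * h) * z \<longrightarrow> z * b = b * z"
    using B_sqrt[OF B_minus[OF B_mult[OF h(1) h(1)]]] by blast
  have hb: "h * b = b * h"
    using b(4) by (simp add: mult.assoc)
  \<comment> \<open>With \<open>b\<close> the root of \<open>1 - h * h\<close>, both
    \<open>b + \<i> *\<^sub>C h\<close> and its adjoint are unitary: the cross terms cancel since
    \<open>b\<close> and \<open>h\<close> commute. Subtracting the two trace identities isolates
    \<open>h\<close>.\<close>
  define u where "u s = b + (s * \<i>) *\<^sub>C h" for s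
  have uB: "u s \<in> B" for s
    by (simp add: u_def b(1) h(1) B_add B_scaleC)
  have star_u: "star (u s) = u (- s)" if "s = 1 \<or> s = - 1" for s
    using that by (auto simp: u_def star_add star_scaleC b(2) h(2))
  have uu: "u (- s) * u s = 1" if "s = 1 \<or> s = - 1" for s
    using that
    by (auto simp: u_def distrib_left distrib_right mult_scaleC_left mult_scaleC_right
        scaleC_scaleC hb b(3) left_diff_distrib right_diff_distrib cvec.scale_right_diff_distrib
        scaleC_minus1)
  have comm: "\<tau> (u s * x) = \<tau> (x * u s)" if s: "s = 1 \<or> s = - 1" for s
  proof -
    have "local_map (\<lambda>x. star (u s) * x * u s + star 0 * x * 0)"
      \<comment> \<open>\<open>B_diff[OF x x]\<close> shows that 0 lies in \<open>B\<close>, as the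
        second Kraus coefficient.\<close>
      by (rule local_map_kraus) (use uB B_diff[OF x x] uu[OF s] star_u[OF s] in auto)
    \<comment> \<open>Conjugation by the unitary turns \<open>u s * x\<close> into
      \<open>x * u s\<close>.\<close>
    from local_invariant[OF this, of "u s * x"] show ?thesis
      using uB x uu[OF s] by (simp add: B_mult star_u[OF s] mult.assoc[symmetric])
  qed
  have "\<tau> (b * x) + \<i> * \<tau> (h * x) = \<tau> (x * b) + \<i> * \<tau> (x * h)"
    "\<tau> (b * x) - \<i> * \<tau> (h * x) = \<tau> (x * b) - \<i> * \<tau> (x * h)"
    using comm[of 1] comm[of "- 1"]
    by (simp_all add: u_def distrib_left distrib_right left_diff_distrib right_diff_distrib
        mult_scaleC_left mult_scaleC_right state_add[OF state] state_diff[OF state] state_scaleC[OF state])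
  then have "2 * (\<i> * \<tau> (h * x)) = 2 * (\<i> * \<tau> (x * h))"
    by algebra
  then show ?thesis
    by simp
qed

lemma B_decompose:
  assumes "c \<in> B"
  obtains h k where "h \<in> B" "k \<in> B" "star h = h" "star k = k" "c = h + \<i> *\<^sub>C k"
proof
  show "(1/2) *\<^sub>C (c + star c) \<in> B" "(- \<i>/2) *\<^sub>C (c - star c) \<in> B"
    using assms by (simp_all only: B_scaleC B_add B_diff B_star)
  show "star ((1/2) *\<^sub>C (c + star c)) = (1/2) *\<^sub>C (c + star c)"
    by (simp add: star_scaleC star_add add.commute)
  show "star ((- \<i>/2) *\<^sub>C (c - star c)) = (- \<i>/2) *\<^sub>C (c - star c)"
    by (simp add: star_scaleC star_diff cvec.scale_right_diff_distrib cvec.scale_minus_left)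
  have "(1/2) *\<^sub>C c + (1/2) *\<^sub>C c = c"
    using scaleC_add_left[of "1/2" "1/2" c] by simp
  then show "c = (1/2) *\<^sub>C (c + star c) + \<i> *\<^sub>C (- \<i>/2) *\<^sub>C (c - star c)"
    by (simp add: scaleC_scaleC cvec.scale_right_diff_distrib scaleC_add_right)
qed

lemma scale_small:
  obtains r :: real where "r > 0" "norm (r *\<^sub>R (h::'a)) < 1"
proof
  have "norm h < norm h + 1" "norm h + 1 > 0"
    by (simp_all add: add_nonneg_pos)
  then show "1 / (norm h + 1) > 0" "norm ((1 / (norm h + 1)) *\<^sub>R h) < 1"
    by (simp_all add: field_simps)
qed

lemma B_scaleR: "x \<in> B \<Longrightarrow> r *\<^sub>R x \<in> B"
  using B_scaleC[of x "complex_of_real r"] by (simp add: scaleC_of_real)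

lemma trace_B:
  assumes c: "c \<in> B" and x: "x \<in> B"
  shows "\<tau> (c * x) = \<tau> (x * c)"
proof -
  have sa: "\<tau> (h * x) = \<tau> (x * h)" if h: "h \<in> B" "star h = h" for h
  proof -
    obtain r :: real where r: "r > 0" "norm (r *\<^sub>R h) < 1"
      by (rule scale_small)
    have "\<tau> (r *\<^sub>R h * x) = \<tau> (x * r *\<^sub>R h)"
      using h r x by (intro trace_selfadjoint) (simp_all add: B_scaleR star_scaleR)
    then show ?thesis
      using r by (simp add: state_scaleR[OF state])
  qed
  obtain h k where hk: "h \<in> B" "k \<in> B" "star h = h" "star k = k" "c = h + \<i> *\<^sub>C k"
    using B_decompose[OF c] by blast
  show ?thesis
    using sa[of h] sa[of k] hk
    by (simp add: distrib_left distrib_right mult_scaleC_left mult_scaleC_right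
        state_add[OF state] state_scaleC[OF state])
qed

lemma tracial: "tracial \<tau>"
proof -
  note cont = continuous_state[OF state]
  have 1: "\<tau> (a * b) = \<tau> (b * a)" if "b \<in> B" for a b
    by (rule closed_eq_on_dense[OF _ _ B_dense, of "\<lambda>a. \<tau> (a * b)"])
       (auto intro!: cont continuous_intros trace_B that)
  have "\<tau> (a * b) = \<tau> (b * a)" for a b
    by (rule closed_eq_on_dense[OF _ _ B_dense, of "\<lambda>b. \<tau> (a * b)"])
       (auto intro!: cont continuous_intros 1)
  then show ?thesis
    by (simp add: tracial_def)
qed

section \<open>Vanishing of commutators in the GNS representation\<close>

lemma trace: "\<tau> (a * b) = \<tau> (b * a)"
  using tracial by (simp add: tracial_def)

text \<open>Cyclicity collects the Kraus coefficients to the right of \<open>x\<close>, where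
  invariance leaves \<open>c * star c\<close> against \<open>star c * c\<close>. Rescaling
  \<open>c\<close> to norm below 1 provides the root and affects both sides by the same
  factor.\<close>

lemma commutator_star:
  assumes c: "c \<in> B" and x: "x \<in> B"
  shows "\<tau> (x * (c * star c)) = \<tau> (x * (star c * c))"
proof -
  obtain r :: real where r: "r > 0" "norm (r *\<^sub>R c) < 1"
    by (rule scale_small)
  let ?c = "r *\<^sub>R c"
  have cB: "?c \<in> B"
    using c by (rule B_scaleR)
  have "norm (- (star ?c * ?c)) < 1"
    using r(2) cstar_identity[of ?c] by (simp only: norm_minus_cancel power_less_one_iff norm_ge_zero) simp
  moreover have "star (- (star ?c * ?c)) = - (star ?c * ?c)"
    by (simp only: star_minus star_mult star_star)
  ultimately obtain b where b: "b \<in> B" "star b = b" "b * b = 1 + - (star ?c * ?c)"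
    using B_sqrt[OF B_minus[OF B_mult[OF B_star[OF cB] cB]]] by blast
  have "local_map (\<lambda>x. star ?c * x * ?c + star b * x * b)"
    using cB b by (intro local_map_kraus) auto
  from local_invariant[OF this x] have "\<tau> x = \<tau> (star ?c * x * ?c) + \<tau> (b * x * b)"
    by (simp add: b state_add[OF state])
  also have "\<tau> (star ?c * x * ?c) = \<tau> (x * (?c * star ?c))"
    using trace[of "star ?c" "x * ?c"] by (simp add: mult.assoc)
  also have "\<tau> (b * x * b) = \<tau> (x * (b * b))"
    using trace[of b "x * b"] by (simp add: mult.assoc)
  also have "\<dots> = \<tau> x - \<tau> (x * (star ?c * ?c))"
    unfolding b(3) by (simp add: right_diff_distrib state_diff[OF state])
  finally show ?thesis
    using r(1) by (simp add: star_scaleR state_scaleR[OF state])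
qed

lemma commutator_B:
  assumes "a \<in> B" "b \<in> B" "x \<in> B"
  shows "\<tau> (x * (a * b)) = \<tau> (x * (b * a))"
proof -
  note simps = distrib_left distrib_right mult_scaleC_left mult_scaleC_right right_diff_distrib
    left_diff_distrib state_add[OF state] state_diff[OF state] state_scaleC[OF state] mult.assoc
  have sa: "\<tau> (x * (h * k)) = \<tau> (x * (k * h))"
    if "h \<in> B" "k \<in> B" "star h = h" "star k = k" for h k
  proof -
    \<comment> \<open>For \<open>c = h + \<i> *\<^sub>C k\<close> the difference
      \<open>c * star c - star c * c\<close> is \<open>-2\<i>\<close> times the commutator of
      \<open>h\<close> and \<open>k\<close>.\<close>
    have "h + \<i> *\<^sub>C k \<in> B"
      using that by (simp add: B_add B_scaleC)
    from commutator_star[OF this assms(3)] show ?thesis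
      using that by (simp add: star_add star_scaleC simps)
  qed
  obtain h k where "h \<in> B" "k \<in> B" "star h = h" "star k = k" "a = h + \<i> *\<^sub>C k"
    using B_decompose[OF assms(1)] by blast
  moreover obtain h' k' where "h' \<in> B" "k' \<in> B" "star h' = h'" "star k' = k'" "b = h' + \<i> *\<^sub>C k'"
    using B_decompose[OF assms(2)] by blast
  ultimately show ?thesis
    by (simp add: simps sa)
qed

lemma commutator: "\<tau> (x * (a * b)) = \<tau> (x * (b * a))"
proof -
  note cont = continuous_state[OF state]
  have 1: "\<tau> (x * (a * b)) = \<tau> (x * (b * a))" if "a \<in> B" "b \<in> B" for a b x
    by (rule closed_eq_on_dense[OF _ _ B_dense, of "\<lambda>x. \<tau> (x * (a * b))"])
       (auto intro!: cont continuous_intros commutator_B that)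
  have 2: "\<tau> (x * (a * b)) = \<tau> (x * (b * a))" if "b \<in> B" for a b x
    by (rule closed_eq_on_dense[OF _ _ B_dense, of "\<lambda>a. \<tau> (x * (a * b))"])
       (auto intro!: cont continuous_intros 1 that)
  show ?thesis
    by (rule closed_eq_on_dense[OF _ _ B_dense, of "\<lambda>b. \<tau> (x * (a * b))"])
       (auto intro!: cont continuous_intros 2)
qed

text \<open>Cyclicity moves the right factor \<open>z\<close> to the front, which leaves the
  commutator last, where \<open>commutator\<close> annihilates it.\<close>

lemma gns_norm_commutator: "gns_norm \<tau> (a * (b * z) - b * (a * z)) = 0"
proof -
  let ?d = "a * b - b * a"
  have "\<tau> (star (?d * z) * (?d * z)) = \<tau> (star (?d * z) * ?d * z)"
    by (simp add: mult.assoc)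
  also have "\<dots> = \<tau> (z * star (?d * z) * ?d)"
    using trace[of "star (?d * z) * ?d" z] by (simp add: mult.assoc)
  also have "\<dots> = 0"
    using commutator[of "z * star (?d * z)" a b] by (simp add: right_diff_distrib state_diff[OF state])
  finally show ?thesis
    by (simp add: gns_norm_def left_diff_distrib mult.assoc)
qed

lemma abelian: "abelian_operators (gns_space \<tau>) (range (gns_rep \<tau>))"
proof -
  have "gns_rep \<tau> a (gns_rep \<tau> b X) = gns_rep \<tau> b (gns_rep \<tau> a X)" if X: "X \<in> gns_space \<tau>" for a b X
  proof -
    obtain x where x: "x \<in> gns_cauchy \<tau>" "X = gns_rel \<tau> `` {x}"
      using X unfolding gns_space_def by (blast elim: quotientE)
    have "((\<lambda>n. a * (b * x n)), (\<lambda>n. b * (a * x n))) \<in> gns_rel \<tau>"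
      using x(1) by (simp add: gns_rel_def gns_cauchy_mult[OF state] gns_norm_commutator)
    then show ?thesis
      by (simp add: x gns_rep_class[OF state] gns_cauchy_mult[OF state]
          equiv_class_eq[OF gns_rel_equiv[OF state]])
  qed
  then show ?thesis
    by (auto simp: abelian_operators_def compose_def restrict_def fun_eq_iff)
qed

end

section \<open>The asymptotically abelian system of an automorphism\<close>

context star_action
begin

text \<open>
  The elements lying in the bicommutant of finitely many translates of elements of \<open>B\<close>. Unlike
  the algebra generated by the translates, this set is also closed under square roots.
\<close>

definition local_hull :: "'a set \<Rightarrow> 'a set" where
  "local_hull B = {x. \<exists>F. finite F \<and> F \<subseteq> (\<Union>k. A k ` B) \<and>
     (\<forall>z. (\<forall>a\<in>F. z * a = a * z \<and> z * star a = star a * z) \<longrightarrow> z * x = x * z)}"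

lemma local_hullE:
  assumes "x \<in> local_hull B"
  obtains F where "finite F" "F \<subseteq> (\<Union>k. A k ` B)"
    "\<forall>z. (\<forall>a\<in>F. z * a = a * z \<and> z * star a = star a * z) \<longrightarrow> z * x = x * z"
  using assms unfolding local_hull_def mem_Collect_eq by (elim exE conjE)

lemma local_hullI:
  assumes "finite F" "F \<subseteq> (\<Union>k. A k ` B)"
    and "\<And>z. (\<And>a. a \<in> F \<Longrightarrow> z * a = a * z \<and> z * star a = star a * z) \<Longrightarrow> z * x = x * z"
  shows "x \<in> local_hull B"
proof -
  have "\<forall>z. (\<forall>a\<in>F. z * a = a * z \<and> z * star a = star a * z) \<longrightarrow> z * x = x * z"
    using assms(3) by blast
  then show ?thesis
    unfolding local_hull_def mem_Collect_eq using assms(1,2) by (intro exI[of _ F] conjI)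
qed

lemma local_hull_superset: "B \<subseteq> local_hull B"
proof
  fix x
  assume "x \<in> B"
  then have "x \<in> A 0 ` B"
    by simp
  then have "{x} \<subseteq> (\<Union>k. A k ` B)"
    by blast
  then show "x \<in> local_hull B"
    by (rule local_hullI[rotated]) auto
qed

lemma local_hull_commutant:
  assumes "x \<in> local_hull B" "\<And>z. z * x = x * z \<Longrightarrow> z * y = y * z"
  shows "y \<in> local_hull B"
proof -
  obtain F where F: "finite F" "F \<subseteq> (\<Union>k. A k ` B)"
    "\<forall>z. (\<forall>a\<in>F. z * a = a * z \<and> z * star a = star a * z) \<longrightarrow> z * x = x * z"
    by (rule local_hullE[OF assms(1)])
  show ?thesis
  proof (rule local_hullI[OF F(1,2)])
    fix z
    assume "\<And>a. a \<in> F \<Longrightarrow> z * a = a * z \<and> z * star a = star a * z"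
    then show "z * y = y * z"
      using F(3) by (intro assms(2)) blast
  qed
qed

text \<open>Serves sums and products: they lie in the bicommutant of their two operands, and the
  union of both finite sets witnesses this.\<close>

lemma local_hull_commutant2:
  assumes x: "x \<in> local_hull B" and y: "y \<in> local_hull B"
    and w: "\<And>z. z * x = x * z \<Longrightarrow> z * y = y * z \<Longrightarrow> z * w = w * z"
  shows "w \<in> local_hull B"
proof -
  obtain F where F: "finite F" "F \<subseteq> (\<Union>k. A k ` B)"
    "\<forall>z. (\<forall>a\<in>F. z * a = a * z \<and> z * star a = star a * z) \<longrightarrow> z * x = x * z"
    by (rule local_hullE[OF x])
  obtain G where G: "finite G" "G \<subseteq> (\<Union>k. A k ` B)"
    "\<forall>z. (\<forall>a\<in>G. z * a = a * z \<and> z * star a = star a * z) \<longrightarrow> z * y = y * z"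
    by (rule local_hullE[OF y])
  show ?thesis
  proof (rule local_hullI[of "F \<union> G"])
    fix z
    assume "\<And>a. a \<in> F \<union> G \<Longrightarrow> z * a = a * z \<and> z * star a = star a * z"
    then show "z * w = w * z"
      using F(3) G(3) by (intro w) blast+
  qed (use F G in auto)
qed

text \<open>The elements \<open>z\<close> commuting with every \<open>a\<close> and
  \<open>star a\<close> form a set closed under \<open>star\<close>, so the hypothesis can be
  applied to \<open>star z\<close>.\<close>

lemma local_hull_star:
  assumes x: "x \<in> local_hull B"
  shows "star x \<in> local_hull B"
proof -
  obtain F where F: "finite F" "F \<subseteq> (\<Union>k. A k ` B)"
    "\<forall>z. (\<forall>a\<in>F. z * a = a * z \<and> z * star a = star a * z) \<longrightarrow> z * x = x * z"
    by (rule local_hullE[OF x])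
  show ?thesis
  proof (rule local_hullI[OF F(1,2)])
    fix z
    assume z: "\<And>a. a \<in> F \<Longrightarrow> z * a = a * z \<and> z * star a = star a * z"
    have "star z * x = x * star z"
    proof (rule F(3)[THEN spec, THEN mp, OF ballI])
      fix a
      assume "a \<in> F"
      from z[OF this] have "star (z * a) = star (a * z)" "star (z * star a) = star (star a * z)"
        by simp_all
      then show "star z * a = a * star z \<and> star z * star a = star a * star z"
        by (simp add: star_mult)
    qed
    then have "star (star z * x) = star (x * star z)"
      by simp
    then show "z * star x = star x * z"
      by (simp add: star_mult)
  qed
qed

lemma local_hull_A:
  assumes x: "x \<in> local_hull B"
  shows "A j x \<in> local_hull B"
proof -
  obtain F where F: "finite F" "F \<subseteq> (\<Union>k. A k ` B)"
    "\<forall>z. (\<forall>a\<in>F. z * a = a * z \<and> z * star a = star a * z) \<longrightarrow> z * x = x * z"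
    by (rule local_hullE[OF x])
  show ?thesis
  proof (rule local_hullI[of "A j ` F"])
    show "A j ` F \<subseteq> (\<Union>k. A k ` B)"
    proof clarify
      fix a
      assume "a \<in> F"
      with F(2) obtain k b where "b \<in> B" "a = A k b"
        by blast
      then show "A j a \<in> (\<Union>k. A k ` B)"
        by (auto simp: A_A)
    qed
    fix z
    assume z: "\<And>a. a \<in> A j ` F \<Longrightarrow> z * a = a * z \<and> z * star a = star a * z"
    have "A (- j) z * x = x * A (- j) z"
    proof (rule F(3)[THEN spec, THEN mp, OF ballI])
      fix a
      assume "a \<in> F"
      with z have "z * A j a = A j a * z" "z * star (A j a) = star (A j a) * z"
        by blast+
      then have "A (- j) (z * A j a) = A (- j) (A j a * z)"
        "A (- j) (z * A j (star a)) = A (- j) (A j (star a) * z)"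
        by (simp_all add: A_star)
      then show "A (- j) z * a = a * A (- j) z \<and> A (- j) z * star a = star a * A (- j) z"
        by (simp add: A_mult A_A)
    qed
    then have "A j (A (- j) z * x) = A j (x * A (- j) z)"
      by simp
    then show "z * A j x = A j x * z"
      by (simp add: A_mult A_A)
  qed (use F in simp)
qed

text \<open>Commutation passes through the two bicommutants in turn: far translates of
  \<open>F\<close> commute with \<open>G\<close>, hence with \<open>y\<close>; then
  \<open>A (- j) y\<close> commutes with \<open>F\<close>, hence with \<open>x\<close>.\<close>

lemma local_hull_commute:
  assumes B_star: "\<And>a. a \<in> B \<Longrightarrow> star a \<in> B"
    and comm: "\<And>a b. a \<in> B \<Longrightarrow> b \<in> B \<Longrightarrow> \<exists>p. \<forall>j. \<bar>j\<bar> \<ge> p \<longrightarrow> A j a * b = b * A j a"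
    and x: "x \<in> local_hull B" and y: "y \<in> local_hull B"
  shows "\<exists>p. \<forall>j. \<bar>j\<bar> \<ge> p \<longrightarrow> A j x * y = y * A j x"
proof -
  let ?U = "\<Union>k. A k ` B"
  have U_star: "star a \<in> ?U" if "a \<in> ?U" for a
    using that B_star by (force simp: A_star[symmetric])
  have U_comm: "\<exists>p. \<forall>j. \<bar>j\<bar> \<ge> p \<longrightarrow> A j a * b = b * A j a" if ab: "a \<in> ?U" "b \<in> ?U" for a b
  proof -
    obtain k a' where a: "a' \<in> B" "a = A k a'"
      using ab(1) by blast
    obtain l b' where b: "b' \<in> B" "b = A l b'"
      using ab(2) by blast
    obtain p where p: "\<And>j. \<bar>j\<bar> \<ge> p \<Longrightarrow> A j a' * b' = b' * A j a'"
      using comm[OF a(1) b(1)] by blast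
    \<comment> \<open>Relative to \<open>b = A l b'\<close>, the translate of
      \<open>a = A k a'\<close> sits at \<open>j + k - l\<close>.\<close>
    have "A j a * b = b * A j a" if "\<bar>j\<bar> \<ge> p + \<bar>k\<bar> + \<bar>l\<bar>" for j
    proof -
      have "A l (A (j + k - l) a' * b') = A l (b' * A (j + k - l) a')"
        using that by (subst p) auto
      then show ?thesis
        by (simp add: a b A_mult A_A)
    qed
    then show ?thesis
      by blast
  qed
  obtain F where F: "finite F" "F \<subseteq> ?U"
    "\<forall>z. (\<forall>a\<in>F. z * a = a * z \<and> z * star a = star a * z) \<longrightarrow> z * x = x * z"
    by (rule local_hullE[OF x])
  obtain G where G: "finite G" "G \<subseteq> ?U"
    "\<forall>z. (\<forall>a\<in>G. z * a = a * z \<and> z * star a = star a * z) \<longrightarrow> z * y = y * z"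
    by (rule local_hullE[OF y])
  let ?F = "F \<union> star ` F" and ?G = "G \<union> star ` G"
  have "?F \<subseteq> ?U"
    by (intro Un_least F(2) image_subsetI U_star subsetD[OF F(2)])
  moreover have "?G \<subseteq> ?U"
    by (intro Un_least G(2) image_subsetI U_star subsetD[OF G(2)])
  ultimately have "\<forall>a\<in>?F. \<forall>b\<in>?G. \<exists>p. \<forall>j. \<bar>j\<bar> \<ge> p \<longrightarrow> A j a * b = b * A j a"
    using U_comm subsetD by meson
  then obtain p where
    p: "\<And>a b j. a \<in> ?F \<Longrightarrow> b \<in> ?G \<Longrightarrow> \<bar>j\<bar> \<ge> p a b \<Longrightarrow> A j a * b = b * A j a"
    by metis
  define q where "q = Max (insert 0 ((\<lambda>(a, b). p a b) ` (?F \<times> ?G)))"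
  have q: "p a b \<le> q" if "a \<in> ?F" "b \<in> ?G" for a b
    unfolding q_def using F(1) G(1) that by (intro Max_ge) auto
  have "A j x * y = y * A j x" if j: "\<bar>j\<bar> \<ge> q" for j
  proof -
    have ay: "A j a * y = y * A j a" if "a \<in> ?F" for a
    proof (rule G(3)[THEN spec, THEN mp, OF ballI])
      fix b
      assume "b \<in> G"
      then have "b \<in> ?G" "star b \<in> ?G"
        by auto
      then show "A j a * b = b * A j a \<and> A j a * star b = star b * A j a"
        using p[OF that _ order_trans[OF q[OF that] j]] by blast
    qed
    have "A (- j) y * x = x * A (- j) y"
    proof (rule F(3)[THEN spec, THEN mp, OF ballI])
      fix a
      assume "a \<in> F"
      then have "A (- j) (A j a * y) = A (- j) (y * A j a)"
        "A (- j) (A j (star a) * y) = A (- j) (y * A j (star a))"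
        by (simp_all add: ay)
      then show "A (- j) y * a = a * A (- j) y \<and> A (- j) y * star a = star a * A (- j) y"
        by (simp add: A_mult A_A)
    qed
    then have "A j (A (- j) y * x) = A j (x * A (- j) y)"
      by simp
    then show ?thesis
      by (simp add: A_mult A_A)
  qed
  then show ?thesis
    by blast
qed

lemma asymp_abelian_system_local_hull:
  assumes B: "star_subalgebra B" "closure B = UNIV"
    and comm: "\<And>a b. a \<in> B \<Longrightarrow> b \<in> B \<Longrightarrow> \<exists>p. \<forall>j. \<bar>j\<bar> \<ge> p \<longrightarrow> A j a * b = b * A j a"
  shows "asymp_abelian_system A (local_hull B)"
proof
  show "x + y \<in> local_hull B" if "x \<in> local_hull B" "y \<in> local_hull B" for x y
    by (rule local_hull_commutant2[OF that]) (simp add: distrib_left distrib_right)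
  show "x * y \<in> local_hull B" if "x \<in> local_hull B" "y \<in> local_hull B" for x y
    by (rule local_hull_commutant2[OF that]) (metis mult.assoc)
  show "c *\<^sub>C x \<in> local_hull B" if "x \<in> local_hull B" for c x
    by (rule local_hull_commutant[OF that]) (simp add: mult_scaleC_left mult_scaleC_right)
  show "1 \<in> local_hull B"
    by (rule local_hullI[of "{}"]) auto
  show "\<exists>b\<in>local_hull B. star b = b \<and> b * b = 1 + h \<and> (\<forall>z. z * h = h * z \<longrightarrow> z * b = b * z)"
    if h: "h \<in> local_hull B" "star h = h" "norm h < 1" for h
  proof -
    obtain b where b: "star b = b" "b * b = 1 + h" "\<And>z. z * h = h * z \<Longrightarrow> z * b = b * z"
      using cstar_sqrt_commutant[OF h(2,3)] by metis
    then show ?thesis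
      using local_hull_commutant[OF h(1) b(3)] by blast
  qed
  show "closure (local_hull B) = UNIV"
    using closure_mono[OF local_hull_superset[of B]] B(2) by auto
  show "\<exists>p. \<forall>j. \<bar>j\<bar> \<ge> p \<longrightarrow> A j x * y = y * A j x"
    if "x \<in> local_hull B" "y \<in> local_hull B" for x y
    by (rule local_hull_commute[OF _ comm that]) (use B(1) in \<open>auto simp: star_subalgebra_def\<close>)
  show "star x \<in> local_hull B" if "x \<in> local_hull B" for x
    using that by (rule local_hull_star)
  show "A j x \<in> local_hull B" if "x \<in> local_hull B" for j x
    using that by (rule local_hull_A)
qed

end

section \<open>Integer iterates of an automorphism\<close>

lemma int_iterate_0: "int_iterate f 0 x = x"
  by (simp add: int_iterate_def)

lemma int_iterate_Suc:
  assumes "bij f"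
  shows "int_iterate f (j + 1) x = f (int_iterate f j x)"
proof (cases "j \<ge> 0")
  case True
  then show ?thesis
    by (simp add: int_iterate_def nat_add_distrib)
next
  case False
  then have "nat (- j) = Suc (nat (- (j + 1)))"
    by auto
  then show ?thesis
    using False assms by (auto simp: int_iterate_def bij_is_surj surj_f_inv_f)
qed

lemma int_iterate_pred:
  assumes "bij f"
  shows "f (int_iterate f (j - 1) x) = int_iterate f j x"
  using int_iterate_Suc[OF assms, of "j - 1"] by simp

text \<open>For the downward induction step \<open>f\<close> is applied to both sides and cancelled
  by injectivity, which avoids computing with \<open>inv f\<close>.\<close>

lemma int_iterate_add:
  assumes "bij f"
  shows "int_iterate f i (int_iterate f j x) = int_iterate f (i + j) x"
proof (induction i rule: int_induct[of _ 0])
  case (step1 i)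
  then show ?case
    using int_iterate_Suc[OF assms, of "i + j" x] int_iterate_Suc[OF assms, of i "int_iterate f j x"]
    by (simp add: add.assoc add.commute[of j 1])
next
  case (step2 i)
  have "f (int_iterate f (i - 1) (int_iterate f j x)) = f (int_iterate f (i - 1 + j) x)"
    using int_iterate_pred[OF assms, of "i + j"] step2
    by (simp add: int_iterate_pred[OF assms] algebra_simps)
  then show ?case
    using assms by (simp add: bij_is_inj inj_eq)
qed (simp add: int_iterate_0)

lemma int_iterate_hom:
  assumes f: "bij f" and g: "\<And>x. f (g x) = g (f x)"
  shows "int_iterate f j (g x) = g (int_iterate f j x)"
proof (induction j rule: int_induct[of _ 0])
  case (step2 i)
  have "f (int_iterate f (i - 1) (g x)) = f (g (int_iterate f (i - 1) x))"
    using step2 by (simp add: int_iterate_pred[OF f] g)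
  then show ?case
    using f by (simp add: bij_is_inj inj_eq)
qed (simp_all add: int_iterate_0 int_iterate_Suc[OF f] g)

lemma int_iterate_hom2:
  assumes f: "bij f" and g: "\<And>x y. f (g x y) = g (f x) (f y)"
  shows "int_iterate f j (g x y) = g (int_iterate f j x) (int_iterate f j y)"
proof (induction j rule: int_induct[of _ 0])
  case (step2 i)
  have "f (int_iterate f (i - 1) (g x y)) =
      f (g (int_iterate f (i - 1) x) (int_iterate f (i - 1) y))"
    using step2 by (simp add: int_iterate_pred[OF f] g)
  then show ?case
    using f by (simp add: bij_is_inj inj_eq)
qed (simp_all add: int_iterate_0 int_iterate_Suc[OF f] g)

lemma star_action_int_iterate:
  assumes "star_automorphism \<alpha>"
  shows "star_action (int_iterate \<alpha>)"
proof
  have \<alpha>: "bij \<alpha>" "\<And>x y. \<alpha> (x + y) = \<alpha> x + \<alpha> y" "\<And>c x. \<alpha> (c *\<^sub>C x) = c *\<^sub>C \<alpha> x"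
    "\<And>x y. \<alpha> (x * y) = \<alpha> x * \<alpha> y" "\<And>x. \<alpha> (star x) = star (\<alpha> x)"
    using assms by (auto simp: star_automorphism_def Vector_Spaces.linear_iff)
  fix i j x y c
  show "int_iterate \<alpha> i (int_iterate \<alpha> j x) = int_iterate \<alpha> (i + j) x"
    by (rule int_iterate_add[OF \<alpha>(1)])
  show "int_iterate \<alpha> 0 x = x"
    by (rule int_iterate_0)
  show "int_iterate \<alpha> j (x + y) = int_iterate \<alpha> j x + int_iterate \<alpha> j y"
    by (rule int_iterate_hom2[of \<alpha> "(+)", OF \<alpha>(1,2)])
  show "int_iterate \<alpha> j (x * y) = int_iterate \<alpha> j x * int_iterate \<alpha> j y"
    by (rule int_iterate_hom2[of \<alpha> "(*)", OF \<alpha>(1,4)])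
  show "int_iterate \<alpha> j (c *\<^sub>C x) = c *\<^sub>C int_iterate \<alpha> j x"
    by (rule int_iterate_hom[of \<alpha> "\<lambda>x. c *\<^sub>C x" for c, OF \<alpha>(1,3)])
  show "int_iterate \<alpha> j (star x) = star (int_iterate \<alpha> j x)"
    by (rule int_iterate_hom[of \<alpha> star, OF \<alpha>(1,5)])
qed

theorem proposition5p2:
  fixes \<alpha> :: "'a::cstar_algebra_1 \<Rightarrow> 'a" and \<tau> :: "'a \<Rightarrow> complex"
  assumes "separable_space (euclidean :: 'a topology)"
    and "star_automorphism \<alpha>"
    and "asymp_abelian_with_locality \<alpha>"
    and "invariant_state \<alpha> \<tau>"
    and "\<And>\<sigma>. invariant_state \<alpha> \<sigma> \<Longrightarrow> \<sigma> = \<tau>"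
  shows "tracial \<tau> \<and> abelian_operators (gns_space \<tau>) (range (gns_rep \<tau>))"
proof -
  let ?A = "int_iterate \<alpha>"
  interpret star_action ?A
    using assms(2) by (rule star_action_int_iterate)
  obtain B where B: "star_subalgebra B" "closure B = UNIV"
    "\<And>a b. a \<in> B \<Longrightarrow> b \<in> B \<Longrightarrow> \<exists>p. \<forall>j. \<bar>j\<bar> \<ge> p \<longrightarrow> ?A j a * b = b * ?A j a"
    using assms(3) unfolding asymp_abelian_with_locality_def by metis
  interpret asymp_abelian_system ?A "local_hull B"
    by (rule asymp_abelian_system_local_hull[OF B(1,2)]) (rule B(3))
  have A1: "?A 1 = \<alpha>"
    by (simp add: int_iterate_def fun_eq_iff)
  interpret uniquely_ergodic_system ?A "local_hull B" \<tau>
  proof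
    show "is_state \<tau>" "\<tau> (?A 1 x) = \<tau> x" for x
      using assms(4) by (simp_all add: invariant_state_def A1)
    show "\<sigma> = \<tau>" if "is_state \<sigma>" "\<And>x. \<sigma> (?A 1 x) = \<sigma> x" for \<sigma>
      using that by (intro assms(5)) (simp add: invariant_state_def A1)
  qed
  show ?thesis
    using tracial abelian by blast
qed

end
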